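(* Let $a$ be the left endpoint of a maximal gap of the Lagrange spectrum $\mathbb{L}$. Then $a$ is admissible if and only if there exists a quadratic irrationality $\alpha$ with $\mu(\alpha)=a$.
   Context: For irrational $\alpha$, $\mu(\alpha)=\bigl(\liminf_{p\in\mathbb{Z},q\in\mathbb{N}}|q(q\alpha-p)|\bigr)^{-1}$ (the Lagrange constant). The Lagrange spectrum $\mathbb{L}$ is the set of values $\mu(\alpha)$ over irrational $\alpha$. A maximal gap of $\mathbb{L}$ is an open interval $(a,b)$ with $(a,b)\cap\mathbb{L}=\emptyset$ and $a,b\in\mathbb{L}$. An irrational $\alpha$ is attainable if $|\alpha-p/q|\le 1/(\mu(\alpha)q^2)$ has infinitely many solutions in integers $p,q$ ($q\ge1$). A real $\lambda\in\mathbb{L}$ is admissible if there exists an irrational attainable $\alpha$ with $\mu(\alpha)=\lambda$. *)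

theory Defs
  imports "HOL-Library.Extended_Real" "HOL-Library.Liminf_Limsup"
begin

(* The liminf over pairs (p, q) with q \<ge> 1 is taken along the cofinite filter on
   \<int> \<times> \<nat>\<^sub>\<ge>\<^sub>1: for irrational \<alpha> only finitely many p give a bounded value for a given q,
   so this is the same as letting q tend to infinity.  The constant is extended-real valued,
   with inverse 0 = \<infinity> when the liminf is 0. *)
definition lagrange_const :: "real \<Rightarrow> ereal" where
  "lagrange_const \<alpha> = inverse (Liminf (inf cofinite (principal (UNIV \<times> {1..})))
     (\<lambda>(p :: int, q :: nat). ereal \<bar>real q * (real q * \<alpha> - real_of_int p)\<bar>))"

definition lagrange_spectrum :: "ereal set" where
  "lagrange_spectrum = lagrange_const ` (- \<rat>)"

definition maximal_gap :: "ereal \<Rightarrow> ereal \<Rightarrow> bool" where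
  "maximal_gap a b \<longleftrightarrow> a < b \<and> {a<..<b} \<inter> lagrange_spectrum = {} \<and>
     a \<in> lagrange_spectrum \<and> b \<in> lagrange_spectrum"

definition attainable :: "real \<Rightarrow> bool" where
  "attainable \<alpha> \<longleftrightarrow> \<alpha> \<notin> \<rat> \<and>
     infinite {(p :: int, q :: int). q \<ge> 1 \<and>
       ereal \<bar>\<alpha> - real_of_int p / real_of_int q\<bar>
         \<le> 1 / (lagrange_const \<alpha> * ereal ((real_of_int q)\<^sup>2))}"

definition admissible :: "real \<Rightarrow> bool" where
  "admissible l \<longleftrightarrow> ereal l \<in> lagrange_spectrum \<and>
     (\<exists>\<alpha>. attainable \<alpha> \<and> lagrange_const \<alpha> = ereal l)"

definition quadratic_irrational :: "real \<Rightarrow> bool" where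
  "quadratic_irrational \<alpha> \<longleftrightarrow> \<alpha> \<notin> \<rat> \<and>
     (\<exists>A B C :: int. A \<noteq> 0 \<and>
        real_of_int A * \<alpha>\<^sup>2 + real_of_int B * \<alpha> + real_of_int C = 0)"

end

theory Submission
  imports Defs
begin

text \<open>
  An irrational number is coded by the letters of its Stern--Brocot path; after \<open>n\<close> letters
  \<open>\<alpha>\<close> is described by the future \<open>x\<close> and the past \<open>y\<close> of the path, and the two current
  Farey neighbours approximate \<open>\<alpha>\<close> with constants \<open>x + y\<close> and \<open>1/x + 1/y\<close>. The limit superior
  of these heights is the Lagrange constant, and \<open>\<alpha>\<close> is attainable iff the height is at
  least \<open>\<mu>(\<alpha>)\<close> infinitely often.

  Let \<open>a\<close> be the left endpoint of a gap and \<open>\<alpha>\<close> attainable with \<open>\<mu>(\<alpha>) = a\<close>. A periodic word all of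
  whose long windows recur in \<open>\<alpha>\<close> has Lagrange constant close to \<open>a\<close> or smaller, hence at most \<open>a\<close>.
  So at the positions where \<open>\<alpha>\<close> attains height \<open>a\<close>, no other past with recurrent windows
  may be larger than the actual one. This makes the pasts lexicographically maximal, which forces
  \<open>\<alpha>\<close> to be eventually periodic, that is, quadratic.

  Conversely, let \<open>\<alpha>\<close> be a root of the integral form \<open>f\<close> of discriminant \<open>D\<^sup>2\<close>. The best approximations
  satisfy \<open>f(p, q) = v\<close> for a constant \<open>v\<close> with \<open>|v| = |D| / a\<close>. Moving the primitive vector of one
  of them to \<open>(1, 0)\<close> by a unimodular substitution gives an equivalent number whose form
  has a leading coefficient of the same sign as \<open>v\<close>; this puts the approximations on the side where the
  inequality is attained.
\<close>

section \<open>Approximability and the Lagrange constant\<close>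

text \<open>Asking for arbitrarily large \<open>q\<close>, rather than for infinitely many pairs,
  lets later proofs impose lower bounds on the denominator together with the approximation.\<close>

definition approximable :: "real \<Rightarrow> real \<Rightarrow> bool" where
  "approximable \<alpha> C \<longleftrightarrow>
     (\<forall>Q::int. \<exists>p q::int. q > Q \<and> q \<ge> 1 \<and> \<bar>real_of_int q * (real_of_int q * \<alpha> - real_of_int p)\<bar> \<le> C)"

lemma approximable_mono: "approximable \<alpha> C \<Longrightarrow> C \<le> C' \<Longrightarrow> approximable \<alpha> C'"
  unfolding approximable_def by (meson order_trans)

lemma finite_bounded_denominator:
  "finite {(p::int, q::int). q \<ge> 1 \<and> q \<le> Q \<and> \<bar>real_of_int q * (real_of_int q * \<alpha> - real_of_int p)\<bar> \<le> C}"
proof -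
  let ?B = "\<lceil>real_of_int \<bar>Q\<bar> * \<bar>\<alpha>\<bar> + \<bar>C\<bar>\<rceil>"
  have "{(p::int, q::int). q \<ge> 1 \<and> q \<le> Q \<and> \<bar>real_of_int q * (real_of_int q * \<alpha> - real_of_int p)\<bar> \<le> C}
    \<subseteq> {-?B..?B} \<times> {1..Q}"
  proof (clarify)
    fix p q :: int
    assume q: "q \<ge> 1" "q \<le> Q" and *: "\<bar>real_of_int q * (real_of_int q * \<alpha> - real_of_int p)\<bar> \<le> C"
    have "\<bar>real_of_int q * \<alpha> - real_of_int p\<bar> \<le> real_of_int q * \<bar>real_of_int q * \<alpha> - real_of_int p\<bar>"
      using q mult_right_mono[of 1 "real_of_int q" "\<bar>real_of_int q * \<alpha> - real_of_int p\<bar>"] by simp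
    also have "\<dots> \<le> \<bar>C\<bar>" using * q by (simp add: abs_mult)
    finally have "\<bar>real_of_int p\<bar> \<le> \<bar>real_of_int q * \<alpha>\<bar> + \<bar>C\<bar>" by linarith
    moreover have "\<bar>real_of_int q * \<alpha>\<bar> \<le> real_of_int \<bar>Q\<bar> * \<bar>\<alpha>\<bar>"
      unfolding abs_mult using q by (intro mult_right_mono) auto
    ultimately have "\<bar>real_of_int p\<bar> \<le> real_of_int \<bar>Q\<bar> * \<bar>\<alpha>\<bar> + \<bar>C\<bar>" by linarith
    then show "p \<in> {-?B..?B} \<and> q \<in> {1..Q}" using q
      by simp linarith
  qed
  then show ?thesis by (rule finite_subset) simp
qed

text \<open>Each bound on \<open>q\<close> leaves only finitely many pairs, so an infinite set of
  solutions has unbounded denominators.\<close>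

lemma approximable_iff_infinite:
  "approximable \<alpha> C \<longleftrightarrow>
     infinite {(p::int, q::int). q \<ge> 1 \<and> \<bar>real_of_int q * (real_of_int q * \<alpha> - real_of_int p)\<bar> \<le> C}"
  (is "_ \<longleftrightarrow> infinite ?S")
proof
  assume *: "approximable \<alpha> C"
  show "infinite ?S"
  proof
    assume "finite ?S"
    then have "finite (snd ` ?S)" by simp
    then obtain Q where Q: "\<And>q. q \<in> snd ` ?S \<Longrightarrow> q \<le> Q"
      using bdd_above_finite[of "snd ` ?S"] unfolding bdd_above_def by blast
    obtain p q where "q > Q" "q \<ge> 1" "\<bar>real_of_int q * (real_of_int q * \<alpha> - real_of_int p)\<bar> \<le> C"
      using * unfolding approximable_def by blast
    then have "q \<in> snd ` ?S" by force
    then show False using Q \<open>q > Q\<close> by force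
  qed
next
  assume inf: "infinite ?S"
  show "approximable \<alpha> C"
    unfolding approximable_def
  proof (intro allI, rule ccontr)
    fix Q :: int
    assume *: "\<nexists>p q. q > Q \<and> q \<ge> 1 \<and> \<bar>real_of_int q * (real_of_int q * \<alpha> - real_of_int p)\<bar> \<le> C"
    have "?S \<subseteq> {(p::int, q::int). q \<ge> 1 \<and> q \<le> Q \<and> \<bar>real_of_int q * (real_of_int q * \<alpha> - real_of_int p)\<bar> \<le> C}"
      using * by (auto simp: not_less[symmetric])
    with inf finite_bounded_denominator[of Q \<alpha> C] show False
      using finite_subset by blast
  qed
qed

text \<open>The exceptions to the eventual inequality are the solutions of
  \<open>approximable_iff_infinite\<close>, up to the bijection between positive integers and
  naturals. This translates the filter in \<open>lagrange_const\<close>.\<close>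

lemma not_approximable_iff_eventually:
  "\<not> approximable \<alpha> C \<longleftrightarrow> (\<forall>\<^sub>F (p::int, q::nat) in inf cofinite (principal (UNIV \<times> {1..})).
     \<bar>real q * (real q * \<alpha> - real_of_int p)\<bar> > C)"
proof -
  let ?S = "{(p::int, q::int). q \<ge> 1 \<and> \<bar>real_of_int q * (real_of_int q * \<alpha> - real_of_int p)\<bar> \<le> C}"
  let ?T = "{(p::int, q::nat). q \<ge> 1 \<and> \<bar>real q * (real q * \<alpha> - real_of_int p)\<bar> \<le> C}"
  have "bij_betw (\<lambda>(p, q). (p, int q)) ?T ?S"
    by (rule bij_betw_byWitness[where f' = "\<lambda>(p, q). (p, nat q)"]) auto
  then have "finite ?S \<longleftrightarrow> finite ?T" using bij_betw_finite by blast
  moreover have "?T = {x. \<not> (x \<in> UNIV \<times> {1..} \<longrightarrow> (case x of (p, q) \<Rightarrow> \<bar>real q * (real q * \<alpha> - real_of_int p)\<bar> > C))}"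
    by (auto simp: not_less)
  ultimately show ?thesis
    unfolding approximable_iff_infinite eventually_inf_principal eventually_cofinite by simp
qed

lemma approximable_imp_lagrange_const_ge:
  assumes "approximable \<alpha> (1 / c)" "c > 0"
  shows "lagrange_const \<alpha> \<ge> ereal c"
proof -
  let ?F = "inf cofinite (principal ((UNIV :: int set) \<times> {1::nat..}))"
  let ?X = "\<lambda>(p :: int, q :: nat). ereal \<bar>real q * (real q * \<alpha> - real_of_int p)\<bar>"
  have "\<not> Liminf ?F ?X > ereal (1 / c)"
  proof
    assume "Liminf ?F ?X > ereal (1 / c)"
    then have "\<forall>\<^sub>F x in ?F. ?X x > ereal (1 / c)"
      using le_Liminf_iff[of "Liminf ?F ?X" ?F ?X] by blast
    then have "\<not> approximable \<alpha> (1 / c)"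
      unfolding not_approximable_iff_eventually by (rule eventually_mono) auto
    with assms show False by simp
  qed
  moreover have "0 \<le> Liminf ?F ?X" by (intro Liminf_bounded always_eventually) auto
  ultimately have "inverse (ereal (1 / c)) \<le> lagrange_const \<alpha>"
    unfolding lagrange_const_def by (intro ereal_inverse_antimono) auto
  then show ?thesis using assms by simp
qed

text \<open>Strictness matters: at \<open>c\<close> equal to the Lagrange constant the conclusion
  would be attainability, which the limit inferior alone does not decide.\<close>

lemma lagrange_const_gt_imp_approximable:
  assumes "lagrange_const \<alpha> > ereal c" "c > 0"
  shows "approximable \<alpha> (1 / c)"
proof (rule ccontr)
  let ?F = "inf cofinite (principal ((UNIV :: int set) \<times> {1::nat..}))"
  let ?X = "\<lambda>(p :: int, q :: nat). ereal \<bar>real q * (real q * \<alpha> - real_of_int p)\<bar>"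
  assume "\<not> approximable \<alpha> (1 / c)"
  then have "\<forall>\<^sub>F x in ?F. ereal (1 / c) \<le> ?X x"
    unfolding not_approximable_iff_eventually by (rule eventually_mono) auto
  then have "ereal (1 / c) \<le> Liminf ?F ?X" by (rule Liminf_bounded)
  then have "lagrange_const \<alpha> \<le> inverse (ereal (1 / c))"
    unfolding lagrange_const_def using assms by (intro ereal_inverse_antimono) auto
  then show False using assms by simp
qed

lemma attainable_iff_approximable:
  assumes "lagrange_const \<alpha> = ereal a" "a > 0"
  shows "attainable \<alpha> \<longleftrightarrow> \<alpha> \<notin> \<rat> \<and> approximable \<alpha> (1 / a)"
proof -
  have "ereal \<bar>\<alpha> - real_of_int p / real_of_int q\<bar> \<le> 1 / (ereal a * ereal ((real_of_int q)\<^sup>2))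
    \<longleftrightarrow> \<bar>real_of_int q * (real_of_int q * \<alpha> - real_of_int p)\<bar> \<le> 1 / a" if "q \<ge> 1" for p q :: int
  proof -
    have q: "real_of_int q > 0" using that by simp
    have "\<bar>real_of_int q * (real_of_int q * \<alpha> - real_of_int p)\<bar> = (real_of_int q)\<^sup>2 * \<bar>\<alpha> - real_of_int p / real_of_int q\<bar>"
    proof -
      have "real_of_int q * (real_of_int q * \<alpha> - real_of_int p) = (real_of_int q)\<^sup>2 * (\<alpha> - real_of_int p / real_of_int q)"
        using q by (simp add: field_simps power2_eq_square)
      then show ?thesis by (simp add: abs_mult)
    qed
    moreover have "1 / (ereal a * ereal ((real_of_int q)\<^sup>2)) = ereal (1 / (a * (real_of_int q)\<^sup>2))"
      using q assms by (simp add: one_ereal_def)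
    moreover have "Y \<le> 1 / (a * s) \<longleftrightarrow> s * Y \<le> 1 / a" if "s > 0" for Y s :: real
      using that assms by (simp add: field_simps)
    ultimately show ?thesis using q by simp
  qed
  then have "{(p :: int, q :: int). q \<ge> 1 \<and> ereal \<bar>\<alpha> - real_of_int p / real_of_int q\<bar>
         \<le> 1 / (lagrange_const \<alpha> * ereal ((real_of_int q)\<^sup>2))}
    = {(p::int, q::int). q \<ge> 1 \<and> \<bar>real_of_int q * (real_of_int q * \<alpha> - real_of_int p)\<bar> \<le> 1 / a}"
    unfolding assms(1) by auto
  then show ?thesis unfolding attainable_def approximable_iff_infinite by simp
qed

section \<open>Stern--Brocot expansions\<close>

definition step :: "bool \<Rightarrow> real \<Rightarrow> real" where
  "step b y = (if b then y + 1 else y / (1 + y))"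

text \<open>The subtractive continued fraction map; \<open>step\<close> gives its two inverse
  branches. At the value 1 the second branch would divide by zero, but irrational positive starting
  values never reach 1.\<close>

primrec orbit :: "real \<Rightarrow> nat \<Rightarrow> real" where
  "orbit x 0 = x"
| "orbit x (Suc n) = (if orbit x n > 1 then orbit x n - 1 else orbit x n / (1 - orbit x n))"

definition letter :: "real \<Rightarrow> nat \<Rightarrow> bool" where
  "letter x n \<longleftrightarrow> orbit x n > 1"

text \<open>The initial value 1 is the ratio of the denominators of the first Farey pair.\<close>

primrec past :: "real \<Rightarrow> nat \<Rightarrow> real" where
  "past x 0 = 1"
| "past x (Suc n) = step (letter x n) (past x n)"

definition height :: "real \<Rightarrow> nat \<Rightarrow> real" where
  "height x n = max (orbit x n + past x n) (1 / orbit x n + 1 / past x n)"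

lemma step_pos: "y > 0 \<Longrightarrow> step b y > 0"
  by (simp add: step_def)

lemma past_pos: "past x n > 0"
  by (induction n) (simp_all add: step_pos)

lemma orbit_pos_irrational:
  assumes "x > 0" "x \<notin> \<rat>"
  shows "orbit x n > 0 \<and> orbit x n \<notin> \<rat>"
proof (induction n)
  case (Suc n)
  let ?y = "orbit x n"
  have ne: "?y \<noteq> 1" using Suc by auto
  show ?case
  proof (cases "?y > 1")
    case True
    have "?y - 1 \<notin> \<rat>" using Suc Rats_add[of "?y - 1" 1] by auto
    then show ?thesis using True by simp
  next
    case False
    then have "?y < 1" using ne by simp
    have "?y / (1 - ?y) \<notin> \<rat>"
    proof
      assume r: "?y / (1 - ?y) \<in> \<rat>"
      have "1 + ?y / (1 - ?y) = 1 / (1 - ?y)" using \<open>?y < 1\<close> by (simp add: field_simps)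
      then have "?y = ?y / (1 - ?y) / (1 + ?y / (1 - ?y))" using \<open>?y < 1\<close> by simp
      moreover have "?y / (1 - ?y) / (1 + ?y / (1 - ?y)) \<in> \<rat>" using r by (intro Rats_divide[OF r] Rats_add[OF _ r]) auto
      ultimately show False using Suc by simp
    qed
    then show ?thesis using Suc \<open>?y < 1\<close> by simp
  qed
qed (use assms in simp)

lemma orbit_pos: "x > 0 \<Longrightarrow> x \<notin> \<rat> \<Longrightarrow> orbit x n > 0"
  using orbit_pos_irrational by blast

lemma orbit_eq_step:
  assumes "x > 0" "x \<notin> \<rat>"
  shows "orbit x n = step (letter x n) (orbit x (Suc n))"
proof -
  have "orbit x n > 0" "orbit x n \<noteq> 1"
    using orbit_pos_irrational[OF assms, of n] by auto
  then show ?thesis by (auto simp: step_def letter_def field_simps)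
qed

lemma height_ge_1:
  assumes "x > 0" "x \<notin> \<rat>"
  shows "height x n \<ge> 1"
proof (cases "orbit x n \<ge> 1")
  case True
  then show ?thesis using past_pos[of x n] by (simp add: height_def)
next
  case False
  then have "1 / orbit x n \<ge> 1" using orbit_pos[OF assms, of n] by simp
  then show ?thesis using past_pos[of x n] by (simp add: height_def le_max_iff_disj add_increasing2)
qed

text \<open>Inversion exchanges the two letters and the two quantities in \<open>height\<close>, and
  the initial past 1 is its own inverse. Arguments about one letter or one Farey column thus
  transfer to the other.\<close>

lemma inverse_orbit_past:
  assumes "x > 0" "x \<notin> \<rat>"
  shows "orbit (1 / x) n = 1 / orbit x n \<and> past (1 / x) n = 1 / past x n"
    and "letter (1 / x) n \<longleftrightarrow> \<not> letter x n"
    and "height (1 / x) n = height x n"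
proof -
  have lt: "orbit (1 / x) n > 1 \<longleftrightarrow> \<not> orbit x n > 1" if "orbit (1 / x) n = 1 / orbit x n" for n
  proof -
    have "orbit x n > 0" "orbit x n \<noteq> 1"
      using orbit_pos_irrational[OF assms, of n] by auto
    then show ?thesis using that by auto
  qed
  have *: "orbit (1 / x) n = 1 / orbit x n \<and> past (1 / x) n = 1 / past x n" for n
  proof (induction n)
    case (Suc n)
    have pos: "orbit x n > 0" "orbit x n \<noteq> 1" "past x n > 0"
      using orbit_pos_irrational[OF assms, of n] past_pos by auto
    have "orbit (1 / x) (Suc n) = 1 / orbit x (Suc n)"
    proof (cases "orbit x n > 1")
      case True
      moreover have "\<not> orbit (1 / x) n > 1" using True lt Suc by blast
      moreover have "1 / z / (1 - 1 / z) = 1 / (z - 1)" if "z > 1" for z :: real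
        using that by (simp add: field_simps)
      ultimately show ?thesis using Suc by simp
    next
      case False
      moreover have "orbit (1 / x) n > 1" using False lt Suc by blast
      moreover have "1 / z - 1 = 1 / (z / (1 - z))" if "z > 0" for z :: real
        using that by (simp add: field_simps)
      ultimately show ?thesis using Suc pos by simp
    qed
    moreover have "past (1 / x) (Suc n) = 1 / past x (Suc n)"
      using pos lt[of n] Suc by (simp add: letter_def step_def add_divide_distrib distrib_left)
    ultimately show ?case by simp
  qed simp
  show "orbit (1 / x) n = 1 / orbit x n \<and> past (1 / x) n = 1 / past x n" by (fact *)
  show "letter (1 / x) n \<longleftrightarrow> \<not> letter x n" using lt * by (simp add: letter_def)
  show "height (1 / x) n = height x n" using * by (simp add: height_def max.commute)
qed

text \<open>An infinite run of \<open>True\<close> would subtract 1 forever from a positive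
  orbit.\<close>

lemma ex_not_letter_ge:
  assumes "x > 0" "x \<notin> \<rat>"
  shows "\<exists>n\<ge>N. \<not> letter x n"
proof (rule ccontr)
  assume *: "\<not> ?thesis"
  have "orbit x (N + k) = orbit x N - real k" for k
  proof (induction k)
    case (Suc k)
    have "orbit x (N + k) > 1" using * by (simp add: letter_def)
    then show ?case using Suc by simp
  qed simp
  moreover obtain k where "orbit x N < real k" using reals_Archimedean2 by blast
  ultimately have "orbit x (N + k) < 0" by simp
  then show False using orbit_pos[OF assms, of "N + k"] by simp
qed

lemma ex_letter_ge:
  assumes "x > 0" "x \<notin> \<rat>"
  shows "\<exists>n\<ge>N. letter x n"
proof -
  have "1 / x \<notin> \<rat>" using assms Rats_inverse[of "1 / x"] by (auto simp: inverse_eq_divide)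
  then show ?thesis
    using ex_not_letter_ge[of "1 / x" N] assms inverse_orbit_past(2)[OF assms] by auto
qed

section \<open>Farey pairs, their denominators and heights\<close>

definition start :: "real \<Rightarrow> real" where
  "start \<alpha> = frac \<alpha> / (1 - frac \<alpha>)"

lemma start_pos_irrational:
  assumes "\<alpha> \<notin> \<rat>"
  shows "start \<alpha> > 0" "start \<alpha> \<notin> \<rat>"
proof -
  have "frac \<alpha> \<noteq> 0" using assms Ints_subset_Rats by (auto simp: frac_eq_0_iff)
  then have f: "frac \<alpha> > 0" "frac \<alpha> < 1" using frac_ge_0[of \<alpha>] frac_lt_1[of \<alpha>] by linarith+
  then show "start \<alpha> > 0" by (simp add: start_def)
  have "1 + start \<alpha> = 1 / (1 - frac \<alpha>)" using f by (simp add: start_def field_simps)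
  then have "\<alpha> = of_int \<lfloor>\<alpha>\<rfloor> + start \<alpha> / (1 + start \<alpha>)" using f by (simp add: start_def frac_def)
  then show "start \<alpha> \<notin> \<rat>" using assms
    by (metis Rats_1 Rats_add Rats_divide Rats_of_int)
qed

lemma start_of_orbit:
  assumes "x > 0"
  shows "start (x / (1 + x)) = x"
proof -
  have "frac (x / (1 + x)) = x / (1 + x)" using assms by (simp add: frac_eq)
  then show ?thesis using assms by (simp add: start_def field_simps)
qed

text \<open>The entries are the columns \<open>(p, q)\<close>, \<open>(p', q')\<close> of the Stern--Brocot matrix reached after \<open>n\<close>
  letters: \<open>p'/q' < \<alpha> < p/q\<close>.\<close>

primrec farey :: "real \<Rightarrow> nat \<Rightarrow> int \<times> int \<times> int \<times> int" where
  "farey \<alpha> 0 = (\<lfloor>\<alpha>\<rfloor> + 1, 1, \<lfloor>\<alpha>\<rfloor>, 1)"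
| "farey \<alpha> (Suc n) = (case farey \<alpha> n of (p, q, p', q') \<Rightarrow>
     if letter (start \<alpha>) n then (p, q, p + p', q + q') else (p + p', q + q', p', q'))"

text \<open>The orbit is the ratio of the two approximation errors and the past the ratio of the two
  denominators. Passing to the mediant subtracts errors and adds denominators, which matches
  \<open>orbit\<close> and \<open>step\<close>; \<open>start\<close> is the error ratio of the
  initial pair.\<close>

lemma farey_invariant:
  assumes "\<alpha> \<notin> \<rat>" "farey \<alpha> n = (p, q, p', q')"
  shows "p * q' - p' * q = 1" "q \<ge> 1" "q' \<ge> 1" "of_int p - of_int q * \<alpha> > 0"
    "of_int q' * \<alpha> - of_int p' > 0"
    "orbit (start \<alpha>) n = (of_int q' * \<alpha> - of_int p') / (of_int p - of_int q * \<alpha>)"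
    "past (start \<alpha>) n = of_int q' / of_int q"
proof -
  have "p * q' - p' * q = 1 \<and> q \<ge> 1 \<and> q' \<ge> 1 \<and> of_int p - of_int q * \<alpha> > 0 \<and>
    of_int q' * \<alpha> - of_int p' > 0 \<and>
    orbit (start \<alpha>) n = (of_int q' * \<alpha> - of_int p') / (of_int p - of_int q * \<alpha>) \<and>
    past (start \<alpha>) n = of_int q' / of_int q"
    using assms(2)
  proof (induction n arbitrary: p q p' q')
    case 0
    have "frac \<alpha> \<noteq> 0" using assms Ints_subset_Rats by (auto simp: frac_eq_0_iff)
    then have f: "frac \<alpha> > 0" "frac \<alpha> < 1" using frac_ge_0[of \<alpha>] frac_lt_1[of \<alpha>] by linarith+
    then show ?case using 0 by (auto simp: start_def frac_def)
  next
    case (Suc n)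
    obtain r s r' s' where rs: "farey \<alpha> n = (r, s, r', s')" by (metis prod_cases4)
    let ?e = "of_int r - of_int s * \<alpha>" and ?e' = "of_int s' * \<alpha> - of_int r'"
    have IH: "r * s' - r' * s = 1" "s \<ge> 1" "s' \<ge> 1" "?e > 0" "?e' > 0"
      "orbit (start \<alpha>) n = ?e' / ?e" "past (start \<alpha>) n = of_int s' / of_int s"
      using Suc.IH[OF rs] by auto
    have ne: "?e' / ?e \<noteq> 1"
      using orbit_pos_irrational[OF start_pos_irrational[OF assms(1)], of n] IH(6) by auto
    show ?case
    proof (cases "letter (start \<alpha>) n")
      case True
      then have eq: "p = r" "q = s" "p' = r + r'" "q' = s + s'"
        using Suc.prems rs by auto
      have gt: "?e' / ?e > 1" using True IH(6) by (simp add: letter_def)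
      then have "?e' > ?e" using IH by simp
      moreover have "orbit (start \<alpha>) (Suc n) = (?e' - ?e) / ?e"
        using gt IH by (simp add: diff_divide_distrib)
      moreover have "past (start \<alpha>) (Suc n) = of_int s' / of_int s + 1"
        using True IH by (simp add: step_def)
      moreover have "of_int q' * \<alpha> - of_int p' = ?e' - ?e" unfolding eq by (simp add: algebra_simps)
      moreover have "of_int q' / of_int q = of_int s' / of_int s + (1::real)"
        unfolding eq using IH by (simp add: add_divide_distrib)
      moreover have "p * q' - p' * q = 1" unfolding eq using IH(1) by (simp add: algebra_simps)
      ultimately show ?thesis using IH(2-5) eq(1,2,4) by simp
    next
      case False
      then have eq: "p = r + r'" "q = s + s'" "p' = r'" "q' = s'"
        using Suc.prems rs by auto
      have lt: "?e' / ?e < 1" using False IH(6) ne unfolding letter_def by linarith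
      then have l: "?e' < ?e" using IH by simp
      have "orbit (start \<alpha>) (Suc n) = ?e' / ?e / (1 - ?e' / ?e)"
        using lt IH by simp
      also have "1 - ?e' / ?e = (?e - ?e') / ?e" using IH by (simp add: diff_divide_distrib)
      finally have "orbit (start \<alpha>) (Suc n) = ?e' / (?e - ?e')" using IH by simp
      moreover have "past (start \<alpha>) (Suc n) = of_int s' / (of_int s + of_int s')"
      proof -
        have "1 + real_of_int s' / of_int s = (of_int s + of_int s') / of_int s"
          using IH by (simp add: add_divide_distrib)
        then show ?thesis using False IH by (simp add: step_def)
      qed
      moreover have "of_int p - of_int q * \<alpha> = ?e - ?e'" unfolding eq by (simp add: algebra_simps)
      moreover have "p * q' - p' * q = 1" unfolding eq using IH(1) by (simp add: algebra_simps)
      ultimately show ?thesis using IH(2-5) l eq(2-4) by simp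
    qed
  qed
  then show "p * q' - p' * q = 1" "q \<ge> 1" "q' \<ge> 1" "of_int p - of_int q * \<alpha> > 0"
    "of_int q' * \<alpha> - of_int p' > 0"
    "orbit (start \<alpha>) n = (of_int q' * \<alpha> - of_int p') / (of_int p - of_int q * \<alpha>)"
    "past (start \<alpha>) n = of_int q' / of_int q" by auto
qed

text \<open>With errors \<open>e\<close> and \<open>e'\<close> the determinant relation reads
  \<open>q * e' + q' * e = 1\<close>; dividing by \<open>q * e\<close> or by \<open>q' * e'\<close>
  gives the two sums.\<close>

lemma farey_column_values:
  assumes "\<alpha> \<notin> \<rat>" "farey \<alpha> n = (p, q, p', q')"
  shows "1 / (of_int q * (of_int p - of_int q * \<alpha>)) = orbit (start \<alpha>) n + past (start \<alpha>) n"
    and "1 / (of_int q' * (of_int q' * \<alpha> - of_int p')) = 1 / orbit (start \<alpha>) n + 1 / past (start \<alpha>) n"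
proof -
  note inv = farey_invariant[OF assms]
  let ?e = "of_int p - of_int q * \<alpha>" and ?e' = "of_int q' * \<alpha> - of_int p'"
  have q: "real_of_int q > 0" "real_of_int q' > 0" using inv by auto
  have "real_of_int p * of_int q' - of_int p' * of_int q = 1"
    using inv(1) by (metis of_int_1 of_int_diff of_int_mult)
  then have *: "of_int q * ?e' + of_int q' * ?e = 1" by (simp add: algebra_simps)
  have "orbit (start \<alpha>) n + past (start \<alpha>) n = (of_int q * ?e' + of_int q' * ?e) / (of_int q * ?e)"
    using inv q by (simp add: add_divide_distrib)
  then show "1 / (of_int q * ?e) = orbit (start \<alpha>) n + past (start \<alpha>) n" using * by simp
  have "1 / orbit (start \<alpha>) n + 1 / past (start \<alpha>) n = (of_int q * ?e' + of_int q' * ?e) / (of_int q' * ?e')"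
    using inv q by (simp add: add_divide_distrib)
  then show "1 / (of_int q' * ?e') = 1 / orbit (start \<alpha>) n + 1 / past (start \<alpha>) n" using * by simp
qed

text \<open>Both letters occur infinitely often, and each occurrence increases one of the two
  denominators by the other, which is at least 1.\<close>

lemma farey_denominators_unbounded:
  assumes "\<alpha> \<notin> \<rat>"
  shows "\<exists>N. \<forall>n\<ge>N. \<forall>p q p' q'. farey \<alpha> n = (p, q, p', q') \<longrightarrow> q > Q \<and> q' > Q"
proof -
  let ?q = "\<lambda>n. fst (snd (farey \<alpha> n))" and ?q' = "\<lambda>n. snd (snd (snd (farey \<alpha> n)))"
  let ?l = "letter (start \<alpha>)"
  have s: "?q (Suc n) = (if ?l n then ?q n else ?q n + ?q' n)"
    "?q' (Suc n) = (if ?l n then ?q n + ?q' n else ?q' n)" "?q n \<ge> 1" "?q' n \<ge> 1" for n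
    using farey_invariant(2,3)[OF assms, of n] by (cases "farey \<alpha> n"; auto)+
  have mono: "?q n \<le> ?q m \<and> ?q' n \<le> ?q' m" if "n \<le> m" for n m
    using that
  proof (induction m rule: dec_induct)
    case (step m)
    then show ?case using s[of m] by (simp del: farey.simps)
  qed simp
  have "\<exists>n. ?q n > int k" for k
  proof (induction k)
    case 0 then show ?case using s(3)[of 0] by (intro exI[of _ 0]) linarith
  next
    case (Suc k)
    then obtain n where n: "?q n > int k" by blast
    obtain m where m: "m \<ge> n" "\<not> ?l m"
      using ex_not_letter_ge[OF start_pos_irrational[OF assms]] by blast
    have "?q (Suc m) \<ge> ?q n + 1" using m mono[OF m(1)] s(1)[of m] s(4)[of m] by auto
    then show ?case using n by (intro exI[of _ "Suc m"]) linarith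
  qed
  then obtain n1 where "?q n1 > int (nat Q)" by blast
  then have n1: "?q n1 > Q" by linarith
  have "\<exists>n. ?q' n > int k" for k
  proof (induction k)
    case 0 then show ?case using s(4)[of 0] by (intro exI[of _ 0]) linarith
  next
    case (Suc k)
    then obtain n where n: "?q' n > int k" by blast
    obtain m where m: "m \<ge> n" "?l m"
      using ex_letter_ge[OF start_pos_irrational[OF assms]] by blast
    have "?q' (Suc m) \<ge> ?q' n + 1" using m mono[OF m(1)] s(2)[of m] s(3)[of m] by auto
    then show ?case using n by (intro exI[of _ "Suc m"]) linarith
  qed
  then obtain n2 where "?q' n2 > int (nat Q)" by blast
  then have n2: "?q' n2 > Q" by linarith
  show ?thesis
  proof (intro exI[of _ "max n1 n2"] allI impI)
    fix n p q p' q' assume "max n1 n2 \<le> n" "farey \<alpha> n = (p, q, p', q')"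
    then show "q > Q \<and> q' > Q" using mono[of n1 n] mono[of n2 n] n1 n2 by simp
  qed
qed

lemma approximable_if_height:
  assumes "\<alpha> \<notin> \<rat>" "c > 0" "\<forall>N. \<exists>n\<ge>N. height (start \<alpha>) n \<ge> c"
  shows "approximable \<alpha> (1 / c)"
  unfolding approximable_def
proof
  fix Q
  obtain N where N: "\<And>n p q p' q'. n \<ge> N \<Longrightarrow> farey \<alpha> n = (p, q, p', q') \<Longrightarrow> q > Q \<and> q' > Q"
    using farey_denominators_unbounded[OF assms(1)] by blast
  obtain n where n: "n \<ge> N" "height (start \<alpha>) n \<ge> c" using assms by blast
  obtain p q p' q' where f: "farey \<alpha> n = (p, q, p', q')" by (metis prod_cases4)
  note inv = farey_invariant[OF assms(1) f] and val = farey_column_values[OF assms(1) f]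
  have *: "t \<le> 1 / c" if "1 / t \<ge> c" "t > 0" for t :: real
    using that assms(2) by (simp add: field_simps)
  consider "1 / (of_int q * (of_int p - of_int q * \<alpha>)) \<ge> c" | "1 / (of_int q' * (of_int q' * \<alpha> - of_int p')) \<ge> c"
    using n(2) unfolding height_def val by linarith
  then show "\<exists>p q. q > Q \<and> q \<ge> 1 \<and> \<bar>real_of_int q * (real_of_int q * \<alpha> - real_of_int p)\<bar> \<le> 1 / c"
  proof cases
    case 1
    then have "of_int q * (of_int p - of_int q * \<alpha>) \<le> 1 / c" using * inv by simp
    moreover have "\<bar>real_of_int q * (real_of_int q * \<alpha> - real_of_int p)\<bar> = of_int q * (of_int p - of_int q * \<alpha>)"
      using inv by (simp add: abs_mult)
    ultimately show ?thesis using N[OF n(1) f] inv by metis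
  next
    case 2
    then have "of_int q' * (of_int q' * \<alpha> - of_int p') \<le> 1 / c" using * inv by simp
    moreover have "\<bar>real_of_int q' * (real_of_int q' * \<alpha> - real_of_int p')\<bar> = of_int q' * (of_int q' * \<alpha> - of_int p')"
      using inv by (simp add: abs_mult)
    ultimately show ?thesis using N[OF n(1) f] inv by metis
  qed
qed

text \<open>A vector of the cone spanned by the current Farey pair stays in the cones of the later pairs
  until \<open>\<alpha>\<close> and the vector are separated by the mediant; at that moment one of the two columns is a better
  approximation.\<close>

lemma cone_vector_dominated:
  fixes s t :: nat
  assumes "\<alpha> \<notin> \<rat>" "farey \<alpha> n = (a, b, a', b')" "s + t > 0"
    "p = int s * a + int t * a'" "q = int s * b + int t * b'"
  shows "\<exists>m\<ge>n. 1 / height (start \<alpha>) m \<le> \<bar>real_of_int q * (real_of_int q * \<alpha> - real_of_int p)\<bar>"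
  using assms(2-)
proof (induction "s + t" arbitrary: s t n a b a' b' rule: less_induct)
  case less
  note inv = farey_invariant[OF assms(1) less.prems(1)]
  note val = farey_column_values[OF assms(1) less.prems(1)]
  let ?x = "orbit (start \<alpha>) n" and ?y = "past (start \<alpha>) n"
  have x: "?x > 0" "?x \<noteq> 1"
    using orbit_pos_irrational[OF start_pos_irrational[OF assms(1)], of n] by auto
  have y: "?y > 0" by (rule past_pos)
  define e where "e = of_int a - of_int b * \<alpha>"
  have e: "e > 0" using inv by (simp add: e_def)
  have b: "real_of_int b > 0" using inv by simp
  have xe: "of_int b' * \<alpha> - of_int a' = e * ?x" using inv by (simp add: e_def)
  have yb: "of_int b' = of_int b * ?y" using inv by simp
  have "of_int q * \<alpha> - of_int p = real t * (of_int b' * \<alpha> - of_int a') - real s * e"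
    unfolding less.prems e_def by (simp add: algebra_simps)
  also have "\<dots> = e * (real t * ?x - real s)" unfolding xe by (simp add: algebra_simps)
  finally have qp: "of_int q * \<alpha> - of_int p = e * (real t * ?x - real s)" .
  have q: "of_int q = of_int b * (real s + real t * ?y)"
    unfolding less.prems using yb by (simp add: algebra_simps)
  have be: "of_int b * e = 1 / (?x + ?y)"
    using val(1) b e unfolding e_def[symmetric] by (metis div_by_1 divide_divide_eq_right mult_1)
  have be': "of_int b * e * (?x * ?y) = 1 / (1 / ?x + 1 / ?y)"
    unfolding be using x y by (simp add: field_simps)
  have h1: "1 / height (start \<alpha>) n \<le> of_int b * e"
    unfolding be height_def using x y by (intro divide_left_mono) auto
  have h2: "1 / height (start \<alpha>) n \<le> of_int b * e * (?x * ?y)"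
    unfolding be' height_def using x y by (intro divide_left_mono) (auto simp: add_pos_pos less_max_iff_disj)
  \<comment> \<open>In the coordinates \<open>s\<close>, \<open>t\<close> the vector can be compared
    with both columns: \<open>(1, 0)\<close> gives the product \<open>b * e\<close> and
    \<open>(0, 1)\<close> gives \<open>b * e * (?x * ?y)\<close>.\<close>
  have f: "\<bar>real_of_int q * (real_of_int q * \<alpha> - real_of_int p)\<bar> = of_int b * e * (\<bar>real t * ?x - real s\<bar> * (real s + real t * ?y))"
    unfolding qp unfolding q using b e y by (simp add: abs_mult)
  have thesisI: ?case if "of_int b * e \<le> of_int b * e * (\<bar>real t * ?x - real s\<bar> * (real s + real t * ?y)) \<or>
      of_int b * e * (?x * ?y) \<le> of_int b * e * (\<bar>real t * ?x - real s\<bar> * (real s + real t * ?y))"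
    using that h1 h2 unfolding f by (intro exI[of _ n]) auto
  have thesisI1: ?case if "1 \<le> \<bar>real t * ?x - real s\<bar>" "1 \<le> real s + real t * ?y"
  proof (rule thesisI, rule disjI1)
    have "1 \<le> \<bar>real t * ?x - real s\<bar> * (real s + real t * ?y)"
      using mult_mono[OF that] by simp
    then show "of_int b * e \<le> of_int b * e * (\<bar>real t * ?x - real s\<bar> * (real s + real t * ?y))"
      using b e by simp
  qed
  have thesisI2: ?case if "?x \<le> \<bar>real t * ?x - real s\<bar>" "?y \<le> real s + real t * ?y"
    using that x y b e by (intro thesisI disjI2 mult_left_mono mult_mono) auto
  consider (s0) "s = 0" | (t0) "t = 0" | (pos) "s > 0" "t > 0" by blast
  then show ?case
  proof cases
    case s0
    then have "real t \<ge> 1" using less.prems by simp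
    then show ?thesis using x y s0 by (intro thesisI2) (auto simp: abs_mult)
  next
    case t0
    then have "real s \<ge> 1" using less.prems by simp
    then show ?thesis using t0 by (intro thesisI1) auto
  next
    case pos
    show ?thesis
    proof (cases "letter (start \<alpha>) n")
      case True
      then have x1: "?x > 1" by (simp add: letter_def)
      show ?thesis
      \<comment> \<open>If \<open>s \<ge> t\<close>, the vector lies in the next cone with
        coordinates \<open>s - t\<close> and \<open>t\<close>. Otherwise the mediant separates it
        from \<open>\<alpha>\<close>, and the second column is at least as good.\<close>
      proof (cases "s \<ge> t")
        case True
        have fs: "farey \<alpha> (Suc n) = (a, b, a + a', b + b')"
          using less.prems(1) \<open>letter (start \<alpha>) n\<close> by simp
        have "p = int (s - t) * a + int t * (a + a')" "q = int (s - t) * b + int t * (b + b')"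
          unfolding less.prems using True by (auto simp: of_nat_diff algebra_simps)
        then obtain m where "m \<ge> Suc n" "1 / height (start \<alpha>) m \<le> \<bar>real_of_int q * (real_of_int q * \<alpha> - real_of_int p)\<bar>"
          using less.hyps[OF _ fs, of "s - t" t] pos True by auto
        then show ?thesis by (meson Suc_leD)
      next
        case False
        then have "real s \<le> real t - 1" using of_nat_mono[of "Suc s" t, where 'a=real] by simp
        moreover have t1: "real t \<ge> 1" using pos by simp
        then have "(real t - 1) * (?x - 1) \<ge> 0" using x1 by simp
        ultimately have "?x \<le> real t * ?x - real s" by (simp add: algebra_simps)
        moreover have "?y \<le> real t * ?y" using t1 y by simp
        ultimately show ?thesis by (intro thesisI2) auto
      qed
    next
      case False
      then have x1: "?x < 1" using x by (simp add: letter_def)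
      show ?thesis
      proof (cases "t \<ge> s")
        case True
        have fs: "farey \<alpha> (Suc n) = (a + a', b + b', a', b')"
          using less.prems(1) False by simp
        have "p = int s * (a + a') + int (t - s) * a'" "q = int s * (b + b') + int (t - s) * b'"
          unfolding less.prems using True by (auto simp: of_nat_diff algebra_simps)
        then obtain m where "m \<ge> Suc n" "1 / height (start \<alpha>) m \<le> \<bar>real_of_int q * (real_of_int q * \<alpha> - real_of_int p)\<bar>"
          using less.hyps[OF _ fs, of s "t - s"] pos True by auto
        then show ?thesis by (meson Suc_leD)
      next
        case False
        then have "real t \<le> real s - 1" using of_nat_mono[of "Suc t" s, where 'a=real] by simp
        moreover have "real t * ?x \<le> real t" using x1 by (simp add: mult_left_le)
        ultimately have "1 \<le> real s - real t * ?x" by linarith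
        moreover have "0 \<le> real t * ?y" "real s \<ge> 1" using pos y by auto
        ultimately show ?thesis by (intro thesisI1) auto
      qed
    qed
  qed
qed

text \<open>A good approximation with large denominator has nonnegative coordinates in the Farey
  basis at time \<open>N\<close>, so \<open>cone_vector_dominated\<close> supplies a later column
  that is no worse.\<close>

lemma height_if_approximable:
  assumes "\<alpha> \<notin> \<rat>" "c > 0" "approximable \<alpha> (1 / c)"
  shows "\<exists>n\<ge>N. height (start \<alpha>) n \<ge> c"
proof -
  obtain a b a' b' where fN: "farey \<alpha> N = (a, b, a', b')" by (metis prod_cases4)
  note inv = farey_invariant[OF assms(1) fN]
  let ?e = "of_int a - of_int b * \<alpha>" and ?e' = "of_int b' * \<alpha> - of_int a'"
  \<comment> \<open>This bound on \<open>q\<close> pushes the error of \<open>(p, q)\<close> below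
    the error \<open>?e\<close> of the first column. A negative coordinate would force the other to
    be positive, as \<open>q > 0\<close>, and then the error would be at least
    \<open>?e\<close>.\<close>
  obtain p q where pq: "q > \<lceil>1 / (c * ?e)\<rceil>" "q \<ge> 1" "\<bar>real_of_int q * (real_of_int q * \<alpha> - real_of_int p)\<bar> \<le> 1 / c"
    using assms(3) unfolding approximable_def by blast
  define s where "s = b' * p - a' * q"
  define t where "t = a * q - b * p"
  have p: "p = s * a + t * a'" and q: "q = s * b + t * b'"
  proof -
    have "s * a + t * a' = (a * b' - a' * b) * p" "s * b + t * b' = (a * b' - a' * b) * q"
      by (simp_all add: s_def t_def algebra_simps)
    then show "p = s * a + t * a'" "q = s * b + t * b'" using inv by auto
  qed
  have qp: "of_int q * \<alpha> - of_int p = of_int t * ?e' - of_int s * ?e"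
    unfolding p q by (simp add: algebra_simps)
  have "real_of_int q > 1 / (c * ?e)" using pq by linarith
  then have big: "real_of_int q * ?e > 1 / c" using assms(2) inv by (simp add: field_simps)
  have small: "\<bar>of_int t * ?e' - of_int s * ?e\<bar> < ?e"
  proof -
    have "of_int q * \<bar>of_int t * ?e' - of_int s * ?e\<bar> \<le> 1 / c"
      using pq unfolding qp by (simp add: abs_mult)
    also have "\<dots> < real_of_int q * ?e" by (fact big)
    finally show ?thesis using pq by simp
  qed
  have "s \<ge> 0"
  proof (rule ccontr)
    assume "\<not> s \<ge> 0"
    moreover have "t * b' > 0"
    proof (rule ccontr)
      assume "\<not> t * b' > 0"
      moreover have "s * b \<le> 0" using \<open>\<not> s \<ge> 0\<close> inv by (simp add: mult_nonpos_nonneg)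
      ultimately show False using q pq by linarith
    qed
    then have "t > 0" using inv by (simp add: zero_less_mult_iff)
    ultimately have "of_int t * ?e' \<ge> 0" "- of_int s * ?e \<ge> 1 * ?e"
      using inv by (auto intro!: mult_right_mono simp del: mult_minus_left mult_1)
    then show False using small by simp
  qed
  moreover have "t \<ge> 0"
  proof (rule ccontr)
    assume "\<not> t \<ge> 0"
    moreover have "s * b > 0"
    proof (rule ccontr)
      assume "\<not> s * b > 0"
      moreover have "t * b' \<le> 0" using \<open>\<not> t \<ge> 0\<close> inv by (simp add: mult_nonpos_nonneg)
      ultimately show False using q pq by linarith
    qed
    then have "s > 0" using inv by (simp add: zero_less_mult_iff)
    ultimately have "of_int t * ?e' \<le> 0" "of_int s * ?e \<ge> 1 * ?e"
      using inv by (auto intro!: mult_right_mono mult_nonpos_nonneg simp del: mult_1)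
    then show False using small by simp
  qed
  moreover have "s + t \<noteq> 0"
  proof
    assume "s + t = 0"
    then have "s = 0" "t = 0" using calculation by auto
    then show False using q pq by simp
  qed
  ultimately have "nat s + nat t > 0" "int (nat s) = s" "int (nat t) = t" by auto
  then obtain m where m: "m \<ge> N"
    "1 / height (start \<alpha>) m \<le> \<bar>real_of_int q * (real_of_int q * \<alpha> - real_of_int p)\<bar>"
    using cone_vector_dominated[OF assms(1) fN, of "nat s" "nat t" p q] p q by metis
  have "1 / height (start \<alpha>) m \<le> 1 / c" using m pq by linarith
  moreover have "height (start \<alpha>) m > 0"
    using height_ge_1[OF start_pos_irrational[OF assms(1)], of m] by linarith
  ultimately show ?thesis using m(1) assms(2) by (auto simp: field_simps)
qed

lemma approximable_iff_height:
  assumes "\<alpha> \<notin> \<rat>" "c > 0"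
  shows "approximable \<alpha> (1 / c) \<longleftrightarrow> (\<forall>N. \<exists>n\<ge>N. height (start \<alpha>) n \<ge> c)"
  using approximable_if_height height_if_approximable assms by blast

section \<open>Contraction and realisation of words\<close>

definition act :: "bool list \<Rightarrow> real \<Rightarrow> real" where
  "act xs = foldr step xs"

lemma act_simps [simp]: "act [] y = y" "act (x # xs) y = step x (act xs y)"
  "act (xs @ ys) y = act xs (act ys y)"
  by (simp_all add: act_def)

lemma act_pos: "y > 0 \<Longrightarrow> act xs y > 0"
  by (induction xs) (simp_all add: step_pos)

lemma step_nonneg: "y \<ge> 0 \<Longrightarrow> step b y \<ge> 0"
  by (simp add: step_def)

lemma act_nonneg: "y \<ge> 0 \<Longrightarrow> act xs y \<ge> 0"
  by (induction xs) (simp_all add: step_nonneg)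

lemma step_strict_mono: "0 \<le> y \<Longrightarrow> y < z \<Longrightarrow> step b y < step b z"
  by (simp add: step_def field_simps)

lemma act_strict_mono: "0 \<le> y \<Longrightarrow> y < z \<Longrightarrow> act xs y < act xs z"
  by (induction xs) (simp_all add: step_strict_mono act_nonneg)

lemma act_mono: "0 \<le> y \<Longrightarrow> y \<le> z \<Longrightarrow> act xs y \<le> act xs z"
  using act_strict_mono[of y z xs] by (cases "y = z") auto

lemma step_False_diff:
  assumes "y \<ge> 0" "z \<ge> 0"
  shows "\<bar>step False y - step False z\<bar> = \<bar>y - z\<bar> / ((1 + y) * (1 + z))"
proof -
  have "step False y - step False z = (y - z) / ((1 + y) * (1 + z))"
    using assms by (simp add: step_def field_simps)
  then show ?thesis using assms by (simp add: abs_mult)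
qed

lemma act_nonexpansive:
  assumes "y \<ge> 0" "z \<ge> 0"
  shows "\<bar>act xs y - act xs z\<bar> \<le> \<bar>y - z\<bar>"
proof (induction xs)
  case (Cons x xs)
  let ?y = "act xs y" and ?z = "act xs z"
  have nn: "?y \<ge> 0" "?z \<ge> 0" using assms act_nonneg by auto
  have "\<bar>step x ?y - step x ?z\<bar> \<le> \<bar>?y - ?z\<bar>"
  proof (cases x)
    case False
    have "1 \<le> (1 + ?y) * (1 + ?z)" using nn mult_mono[of 1 "1 + ?y" 1 "1 + ?z"] by simp
    then have "\<bar>?y - ?z\<bar> / ((1 + ?y) * (1 + ?z)) \<le> \<bar>?y - ?z\<bar> / 1"
      by (intro divide_left_mono) auto
    then show ?thesis using False step_False_diff[OF nn] by simp
  qed (simp add: step_def)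
  then show ?case using Cons by simp
qed simp

text \<open>Only an occurrence of \<open>[False, True]\<close> contracts: the inner step pushes both points above 1, where the
  derivative of the outer one is at most 1/4.\<close>

lemma act_contract:
  assumes "y \<ge> 0" "z \<ge> 0"
  shows "\<bar>act (xs @ [False, True] @ ys) y - act (xs @ [False, True] @ ys) z\<bar> \<le> \<bar>y - z\<bar> / 4"
proof -
  let ?y = "act ys y" and ?z = "act ys z"
  have nn: "?y \<ge> 0" "?z \<ge> 0" using assms act_nonneg by auto
  have "\<bar>act (xs @ [False, True] @ ys) y - act (xs @ [False, True] @ ys) z\<bar>
    \<le> \<bar>step False (?y + 1) - step False (?z + 1)\<bar>"
    using act_nonexpansive[of "step False (?y + 1)" "step False (?z + 1)" xs] nn
    by (simp add: step_nonneg) (simp add: step_def)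
  also have "\<dots> = \<bar>?y - ?z\<bar> / ((2 + ?y) * (2 + ?z))"
    using step_False_diff[of "?y + 1" "?z + 1"] nn by simp
  also have "\<dots> \<le> \<bar>?y - ?z\<bar> / 4"
    using nn mult_mono[of 2 "2 + ?y" 2 "2 + ?z"] by (intro divide_left_mono) auto
  also have "\<dots> \<le> \<bar>y - z\<bar> / 4"
    using act_nonexpansive[OF assms] by simp
  finally show ?thesis .
qed

text \<open>Runs of equal letters are shorter than \<open>k\<close>, the analogue of bounded partial
  quotients; this makes the contraction of \<open>act\<close> uniform over words.\<close>

definition mixed :: "nat \<Rightarrow> bool list \<Rightarrow> bool" where
  "mixed k xs \<longleftrightarrow> (\<forall>ys zs ws. xs = ys @ zs @ ws \<and> length zs = k \<longrightarrow> True \<in> set zs \<and> False \<in> set zs)"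

lemma mixedD: "mixed k (ys @ zs @ ws) \<Longrightarrow> length zs = k \<Longrightarrow> True \<in> set zs \<and> False \<in> set zs"
  by (auto simp: mixed_def)

lemma mixed_appendD1: "mixed k (xs @ ys) \<Longrightarrow> mixed k xs"
  unfolding mixed_def by (metis append.assoc)

lemma mixed_appendD2: "mixed k (xs @ ys) \<Longrightarrow> mixed k ys"
  unfolding mixed_def by (metis append.assoc)

lemma mixed_rev: "mixed k xs \<Longrightarrow> mixed k (rev xs)"
  unfolding mixed_def by (metis append.assoc length_rev rev_append rev_rev_ident set_rev)

lemma mixed_map_Not:
  assumes "mixed k xs"
  shows "mixed k (map Not xs)"
  unfolding mixed_def
proof (clarify)
  fix ys zs ws assume *: "map Not xs = ys @ zs @ ws" and k: "k = length zs"
  have "xs = map Not (map Not xs)" by (simp add: comp_def)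
  also have "\<dots> = map Not ys @ map Not zs @ map Not ws" unfolding * by simp
  finally have "True \<in> set (map Not zs)" "False \<in> set (map Not zs)"
    using assms k mixedD[of k "map Not ys" "map Not zs" "map Not ws"] by auto
  then show "True \<in> set zs \<and> False \<in> set zs" by auto
qed

lemma mixed_mapI:
  assumes "k > 0" "\<And>i. n \<le> i \<Longrightarrow> i + k \<le> m \<Longrightarrow> (\<exists>j\<in>{i..<i+k}. f j) \<and> (\<exists>j\<in>{i..<i+k}. \<not> f j)"
  shows "mixed k (map f [n..<m])"
  unfolding mixed_def
proof (clarify)
  fix ys zs ws assume *: "map f [n..<m] = ys @ zs @ ws" and k: "k = length zs"
  have len: "length ys + k + length ws = m - n" using arg_cong[OF *, of length] k by simp
  have "zs = take k (drop (length ys) (map f [n..<m]))" unfolding * k by simp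
  also have "\<dots> = map f (take k [n + length ys..<m])" by (simp add: take_map drop_map)
  also have "take k [n + length ys..<m] = [n + length ys..<n + length ys + k]"
  proof -
    \<comment> \<open>\<open>k > 0\<close> makes \<open>m - n\<close> positive, so the subtraction
      in \<open>len\<close> is not truncated.\<close>
    have "n + length ys + k \<le> m" using len \<open>k > 0\<close> by linarith
    then show ?thesis by simp
  qed
  finally have zs: "set zs = f ` {n + length ys..<n + length ys + k}" by simp
  have "n + length ys + k \<le> m" using len \<open>k > 0\<close> by linarith
  then obtain i j where "i \<in> {n + length ys..<n + length ys + k}" "f i"
    "j \<in> {n + length ys..<n + length ys + k}" "\<not> f j"
    using assms(2)[of "n + length ys"] by auto
  then show "True \<in> set zs \<and> False \<in> set zs" unfolding zs image_iff by metis
qed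

lemma ex_False_True:
  "True \<in> set r \<Longrightarrow> \<exists>ys zs. False # r = ys @ [False, True] @ zs"
proof (induction r)
  case (Cons x r)
  show ?case
  proof (cases x)
    case True
    then show ?thesis by (intro exI[of _ "[]"] exI[of _ r]) simp
  next
    case False
    then obtain ys zs where "False # r = ys @ [False, True] @ zs" using Cons by auto
    then show ?thesis using False by (intro exI[of _ "False # ys"] exI[of _ zs]) simp
  qed
qed simp

text \<open>The first block of \<open>k\<close> letters contains \<open>False\<close> and the second
  contains \<open>True\<close>, so a change from \<open>False\<close> to \<open>True\<close> lies
  between.\<close>

lemma mixed_ex_False_True:
  assumes "mixed k xs" "length xs = 2 * k"
  shows "\<exists>ys zs. xs = ys @ [False, True] @ zs"
proof -
  let ?a = "take k xs" and ?b = "drop k xs"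
  have "False \<in> set ?a" using assms mixedD[of k "[]" ?a ?b] by simp
  then obtain p q where pq: "?a = p @ False # q" by (meson split_list)
  have "True \<in> set ?b" using assms mixedD[of k ?a ?b "[]"] by simp
  then obtain ys zs where "False # (q @ ?b) = ys @ [False, True] @ zs"
    using ex_False_True[of "q @ ?b"] by auto
  then have "xs = (p @ ys) @ [False, True] @ zs"
    using pq append_take_drop_id[of k xs] by (metis append.assoc append_Cons)
  then show ?thesis by blast
qed

lemma mixed_contract_power:
  assumes "mixed k xs" "length xs = 2 * k * n" "y \<ge> 0" "z \<ge> 0"
  shows "\<bar>act xs y - act xs z\<bar> \<le> \<bar>y - z\<bar> / 4 ^ n"
  using assms(1,2)
proof (induction n arbitrary: xs)
  case (Suc n)
  let ?a = "take (2 * k) xs" and ?b = "drop (2 * k) xs"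
  have xs: "xs = ?a @ ?b" by simp
  have m: "mixed k ?a" "mixed k ?b" using Suc.prems(1) mixed_appendD1 mixed_appendD2 xs by metis+
  obtain ys zs where ys: "?a = ys @ [False, True] @ zs"
    using mixed_ex_False_True[OF m(1)] Suc.prems by auto
  have "\<bar>act xs y - act xs z\<bar> = \<bar>act ?a (act ?b y) - act ?a (act ?b z)\<bar>"
    by (subst (1 2) xs) (simp only: act_simps)
  also have "\<dots> \<le> \<bar>act ?b y - act ?b z\<bar> / 4"
    unfolding ys by (rule act_contract) (use assms act_nonneg in auto)
  also have "\<dots> \<le> (\<bar>y - z\<bar> / 4 ^ n) / 4"
    using Suc.IH[OF m(2)] Suc.prems by (intro divide_right_mono) auto
  finally show ?case by (simp add: mult.commute)
qed simp

text \<open>A \<open>False\<close> brings the value down to at most 1 whatever follows it, and each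
  \<open>True\<close> in front adds 1.\<close>

lemma act_le_length: "False \<in> set xs \<Longrightarrow> y \<ge> 0 \<Longrightarrow> act xs y \<le> real (length xs)"
proof (induction xs)
  case (Cons x xs)
  show ?case
  proof (cases x)
    case True
    then show ?thesis using Cons by (simp add: step_def)
  next
    case False
    have "act xs y \<ge> 0" using Cons act_nonneg by simp
    then have "step False (act xs y) \<le> 1" by (simp add: step_def)
    then show ?thesis using False by simp
  qed
qed simp

text \<open>\<open>N\<close> must not depend on \<open>y\<close> and \<open>z\<close>. The block
  \<open>?b\<close> contains a \<open>False\<close> and so bounds all values by \<open>k\<close>;
  the \<open>2 * k * n\<close> letters outside it then shrink differences by
  \<open>4 ^ n\<close>.\<close>

lemma mixed_contract:
  assumes "\<delta> > 0"
  obtains N where "\<And>xs y z. mixed k xs \<Longrightarrow> length xs \<ge> N \<Longrightarrow> y > 0 \<Longrightarrow> z > 0 \<Longrightarrow> \<bar>act xs y - act xs z\<bar> < \<delta>"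
proof -
  obtain n where n: "real k / \<delta> < 4 ^ n" using real_arch_pow[of 4 "real k / \<delta>"] by auto
  show ?thesis
  proof (rule that[of "2 * k * n + k"])
    fix xs :: "bool list" and y z :: real
    assume m: "mixed k xs" and len: "2 * k * n + k \<le> length xs" and pos: "y > 0" "z > 0"
    let ?a = "take (2 * k * n) xs" and ?b = "take k (drop (2 * k * n) xs)"
      and ?c = "drop k (drop (2 * k * n) xs)"
    have xs: "xs = ?a @ ?b @ ?c" by (metis append_take_drop_id)
    have lb: "length ?b = k" using len by simp
    have "False \<in> set ?b" using mixedD[of k ?a ?b ?c] m lb xs by metis
    then have b: "act ?b u \<le> real k" if "u > 0" for u using act_le_length[of ?b u] lb that by simp
    have "mixed k ?a" using m mixed_appendD1 xs by metis
    moreover have "length ?a = 2 * k * n" using len by simp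
    ultimately have "\<bar>act ?a (act ?b (act ?c y)) - act ?a (act ?b (act ?c z))\<bar>
      \<le> \<bar>act ?b (act ?c y) - act ?b (act ?c z)\<bar> / 4 ^ n"
      using pos by (intro mixed_contract_power) (auto intro!: act_nonneg)
    also have "\<dots> \<le> real k / 4 ^ n"
    proof -
      have "0 \<le> act ?b (act ?c y)" "act ?b (act ?c y) \<le> real k"
        "0 \<le> act ?b (act ?c z)" "act ?b (act ?c z) \<le> real k"
        using b pos act_pos by (auto intro!: act_nonneg)
      then show ?thesis by (intro divide_right_mono) auto
    qed
    also have "\<dots> < \<delta>" using n assms by (simp add: field_simps)
    finally show "\<bar>act xs y - act xs z\<bar> < \<delta>" by (subst (1 2) xs) (simp only: act_simps)
  qed
qed

lemma act_map_Not: "y > 0 \<Longrightarrow> act (map Not xs) (1 / y) = 1 / act xs y"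
proof (induction xs)
  case (Cons x xs)
  then have "act xs y > 0" by (simp add: act_pos)
  moreover have "1 / z / (1 + 1 / z) = 1 / (z + 1)" "1 / z + 1 = 1 / (z / (1 + z))" if "z > 0" for z :: real
    using that by (simp_all add: field_simps)
  ultimately show ?case using Cons by (simp add: step_def)
qed simp

text \<open>The reciprocals enter through the second term of \<open>height\<close>. Exchanging the
  letters turns them into values of a word that is again \<open>mixed\<close>.\<close>

lemma mixed_contract_both:
  assumes "\<delta> > 0"
  obtains N where "\<And>xs y z. mixed k xs \<Longrightarrow> length xs \<ge> N \<Longrightarrow> y > 0 \<Longrightarrow> z > 0 \<Longrightarrow>
    \<bar>act xs y - act xs z\<bar> < \<delta> \<and> \<bar>1 / act xs y - 1 / act xs z\<bar> < \<delta>"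
proof -
  obtain N where N: "\<And>xs y z. mixed k xs \<Longrightarrow> length xs \<ge> N \<Longrightarrow> y > 0 \<Longrightarrow> z > 0 \<Longrightarrow> \<bar>act xs y - act xs z\<bar> < \<delta>"
    using mixed_contract[OF assms, of k] by blast
  show ?thesis
  proof (rule that[of N])
    fix xs :: "bool list" and y z :: real
    assume *: "mixed k xs" "length xs \<ge> N" "y > 0" "z > 0"
    have "\<bar>act (map Not xs) (1 / y) - act (map Not xs) (1 / z)\<bar> < \<delta>"
      using * mixed_map_Not by (intro N) auto
    then show "\<bar>act xs y - act xs z\<bar> < \<delta> \<and> \<bar>1 / act xs y - 1 / act xs z\<bar> < \<delta>"
      using * N by (simp add: act_map_Not)
  qed
qed

lemma orbit_eq_act:
  assumes "x > 0" "x \<notin> \<rat>"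
  shows "orbit x n = act (map (letter x) [n..<n + l]) (orbit x (n + l))"
proof (induction l)
  case (Suc l)
  then show ?case using orbit_eq_step[OF assms, of "n + l"] by (simp del: orbit.simps)
qed simp

lemma past_eq_act:
  "past x (n + l) = act (rev (map (letter x) [n..<n + l])) (past x n)"
  by (induction l) simp_all

section \<open>Realising prescribed letter sequences\<close>

definition word_value :: "(nat \<Rightarrow> bool) \<Rightarrow> real" where
  "word_value c = (SUP n. act (map c [0..<n]) 0)"

lemma map_upt_shift: "map c [0..<Suc n] = c 0 # map (\<lambda>i. c (Suc i)) [0..<n]"
  by (simp add: upt_conv_Cons map_Suc_upt[symmetric] comp_def del: upt_Suc map_Suc_upt)

lemma step_SUP:
  fixes g :: "nat \<Rightarrow> real"
  assumes "bdd_above (range g)" "\<And>n. g n \<ge> 0"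
  shows "step b (SUP n. g n) = (SUP n. step b (g n))"
proof -
  let ?s = "SUP n. g n"
  have le: "g n \<le> ?s" for n using assms by (intro cSUP_upper) auto
  have "g 0 \<le> ?s" by (rule le)
  then have s0: "?s \<ge> 0" using assms(2)[of 0] by linarith
  show ?thesis
  proof (rule cSup_eq_non_empty[symmetric])
    show "range (\<lambda>n. step b (g n)) \<noteq> {}" by simp
    fix x assume "x \<in> range (\<lambda>n. step b (g n))"
    then show "x \<le> step b ?s"
      using le assms(2) act_mono[of "g _" ?s "[b]"] by auto
  next
    fix y assume y: "\<And>x. x \<in> range (\<lambda>n. step b (g n)) \<Longrightarrow> x \<le> y"
    show "step b ?s \<le> y"
    proof (cases b)
      case True
      have "?s \<le> y - 1" using y True by (intro cSUP_least) (auto simp: step_def algebra_simps)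
      then show ?thesis using True by (simp add: step_def)
    next
      case False
      show ?thesis
      proof (cases "y < 1")
        case True
        have "?s \<le> y / (1 - y)"
        proof (intro cSUP_least)
          fix n
          have "step b (g n) \<le> y" using y by blast
          then show "g n \<le> y / (1 - y)" using True False assms(2)[of n]
            by (simp add: step_def field_simps)
        qed simp
        then show ?thesis using True False s0 by (simp add: step_def field_simps)
      next
        case ge: False
        have "step b ?s \<le> 1" using False s0 by (simp add: step_def)
        then show ?thesis using ge by linarith
      qed
    qed
  qed
qed

text \<open>Extending a word can only raise its value at 0, so boundedness makes
  \<open>word_value\<close> the limit of these values. The bound comes from a prefix that contains a
  \<open>False\<close>.\<close>

lemma act_zero_bdd:
  assumes "\<not> c m"
  shows "bdd_above (range (\<lambda>n. act (map c [0..<n]) 0))"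
proof (rule bdd_aboveI2)
  fix n
  \<comment> \<open>Prolonging the word by \<open>Suc m\<close> letters guarantees that it contains
    the index \<open>m\<close>, even for small \<open>n\<close>.\<close>
  have "act (map c [0..<n]) 0 \<le> act (map c [0..<n]) (act (map c [n..<n + Suc m]) 0)"
    by (intro act_mono act_nonneg) auto
  also have "\<dots> = act (map c [0..<Suc m + n]) 0"
    by (simp only: act_simps(3)[symmetric] map_append[symmetric])
       (metis add.commute le0 upt_add_eq_append)
  also have "\<dots> = act (map c [0..<Suc m]) (act (map c [Suc m..<Suc m + n]) 0)"
    by (simp only: act_simps(3)[symmetric] map_append[symmetric])
       (metis le0 upt_add_eq_append)
  also have "\<dots> \<le> real (Suc m)"
  proof -
    have "act (map c [Suc m..<Suc m + n]) 0 \<ge> 0" by (rule act_nonneg) simp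
    moreover have "False \<in> set (map c [0..<Suc m])" using assms by simp
    ultimately show ?thesis using act_le_length[of "map c [0..<Suc m]"] by fastforce
  qed
  finally show "act (map c [0..<n]) 0 \<le> real (Suc m)" .
qed

lemma word_value_step:
  assumes "\<And>N. \<exists>n\<ge>N. \<not> c n"
  shows "word_value c = step (c 0) (word_value (\<lambda>i. c (Suc i)))"
proof -
  obtain m where m: "\<not> c m" using assms by blast
  obtain m' where "m' \<ge> Suc 0" "\<not> c m'" using assms by blast
  then have m': "\<not> c (Suc (m' - 1))" by simp
  let ?g = "\<lambda>n. act (map (\<lambda>i. c (Suc i)) [0..<n]) 0"
  have "word_value c = (SUP n. act (map c [0..<Suc n]) 0)"
    unfolding word_value_def
  proof (rule antisym)
    have bdd: "bdd_above (range (\<lambda>n. act (map c [0..<Suc n]) 0))"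
      by (rule bdd_above_mono[OF act_zero_bdd[of c, OF m]]) (auto simp del: upt_Suc)
    show "(SUP n. act (map c [0..<n]) 0) \<le> (SUP n. act (map c [0..<Suc n]) 0)"
    proof (rule cSUP_least)
      fix n
      have "act (map c [0..<n]) 0 \<le> act (map c [0..<n]) (act [c n] 0)"
        by (intro act_mono act_nonneg) auto
      also have "\<dots> = act (map c [0..<Suc n]) 0" by simp
      also have "\<dots> \<le> (SUP n. act (map c [0..<Suc n]) 0)" by (rule cSUP_upper[OF _ bdd]) simp
      finally show "act (map c [0..<n]) 0 \<le> (SUP n. act (map c [0..<Suc n]) 0)" .
    qed simp
    show "(SUP n. act (map c [0..<Suc n]) 0) \<le> (SUP n. act (map c [0..<n]) 0)"
      by (intro cSUP_least cSUP_upper[OF _ act_zero_bdd[of c, OF m]]) auto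
  qed
  also have "\<dots> = (SUP n. step (c 0) (?g n))" by (simp only: map_upt_shift act_simps)
  also have "\<dots> = step (c 0) (SUP n. ?g n)"
    using act_zero_bdd[of "\<lambda>i. c (Suc i)", OF m']
    by (intro step_SUP[symmetric]) (auto intro: act_nonneg)
  finally show ?thesis by (simp add: word_value_def)
qed

lemma word_value_nonneg:
  assumes "\<not> c m"
  shows "word_value c \<ge> 0"
  unfolding word_value_def
  using cSUP_upper[OF _ act_zero_bdd[of c, OF assms], of 0] by simp

text \<open>The values \<open>V\<close> of the tails satisfy the recursion of an orbit. They are
  irrational by descent: a value \<open>a / b\<close> would give the next tail a fraction with
  smaller sum of numerator and denominator, and the Euclidean algorithm cannot run forever.\<close>

lemma ex_orbit_with_letters:
  assumes inf: "\<And>N. \<exists>n\<ge>N. c n" "\<And>N. \<exists>n\<ge>N. \<not> c n"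
  obtains x where "x > 0" "x \<notin> \<rat>" "letter x = c"
proof -
  define V where "V n = word_value (\<lambda>i. c (i + n))" for n
  have inf': "\<exists>m\<ge>N. \<not> c (m + n)" for n N
  proof -
    obtain m where "m \<ge> N + n" "\<not> c m" using inf(2) by blast
    then show ?thesis by (intro exI[of _ "m - n"]) auto
  qed
  have V_step: "V n = step (c n) (V (Suc n))" for n
    unfolding V_def using word_value_step[of "\<lambda>i. c (i + n)"] inf' by simp
  have V_nonneg: "V n \<ge> 0" for n
    unfolding V_def using inf' word_value_nonneg by metis
  have V_pos: "V n > 0" for n
  proof -
    obtain m where m: "m \<ge> n" "c m" using inf(1) by blast
    have "V m > 0" using V_step[of m] m V_nonneg[of "Suc m"] by (simp add: step_def)
    with m(1) show ?thesis
    proof (induction n rule: inc_induct)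
      case (step k)
      then show ?case using V_step[of k] step_pos by simp
    qed simp
  qed
  have not_frac: "V n \<noteq> real a / real b" if "a > 0" "b > 0" for a b n
    using that
  proof (induction "a + b" arbitrary: a b n rule: less_induct)
    case less
    show ?case
    proof
      assume eq: "V n = real a / real b"
      note p = V_pos[of "Suc n"]
      show False
      proof (cases "c n")
        case True
        then have V: "V (Suc n) = real a / real b - 1" using V_step[of n] eq by (simp add: step_def)
        then have "b < a" using p less.prems by simp
        then have "V (Suc n) = real (a - b) / real b" using V less.prems
          by (simp add: of_nat_diff diff_divide_distrib)
        then show False using less.hyps[of "a - b" b] less.prems \<open>b < a\<close> by simp
      next
        case False
        then have V: "V (Suc n) / (1 + V (Suc n)) = real a / real b"
          using V_step[of n] eq by (simp add: step_def)
        then have "real a / real b < 1" using p by (metis add.commute divide_less_eq_1_pos less_add_one add_pos_pos zero_less_one)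
        then have "a < b" using less.prems by simp
        then have "V (Suc n) = real a / real (b - a)" using V less.prems p
          by (simp add: of_nat_diff field_simps)
        then show False using less.hyps[of a "b - a"] less.prems \<open>a < b\<close> by simp
      qed
    qed
  qed
  have irr: "V 0 \<notin> \<rat>"
  proof
    assume "V 0 \<in> \<rat>"
    then obtain a b where "b \<noteq> 0" "\<bar>V 0\<bar> = real a / real b"
      using Rats_abs_nat_div_natE by metis
    then show False using not_frac[of a b 0] V_pos[of 0] by (cases "a = 0") auto
  qed
  have V_gt: "V n > 1 \<longleftrightarrow> c n" for n
    using V_step[of n] V_pos[of "Suc n"] by (simp add: step_def)
  have "orbit (V 0) n = V n" for n
  proof (induction n)
    case (Suc n)
    show ?case
    proof (cases "c n")
      case True
      then have "V n > 1" using V_gt by simp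
      then show ?thesis using Suc V_step[of n] True by (simp add: step_def)
    next
      case False
      then have "\<not> V n > 1" using V_gt by simp
      moreover have "V n / (1 - V n) = V (Suc n)"
      proof -
        have "1 - V n = 1 / (1 + V (Suc n))"
          using V_step[of n] V_pos[of "Suc n"] False by (simp add: step_def field_simps)
        then show ?thesis using V_step[of n] V_pos[of "Suc n"] False by (simp add: step_def)
      qed
      ultimately show ?thesis using Suc by simp
    qed
  qed simp
  then have "letter (V 0) = c" using V_gt by (simp add: letter_def fun_eq_iff)
  then show ?thesis using that[of "V 0"] V_pos irr by blast
qed

section \<open>Recurrent windows\<close>

definition recurrent :: "nat \<Rightarrow> (nat \<Rightarrow> bool) \<Rightarrow> (nat \<Rightarrow> bool) \<Rightarrow> bool" where
  "recurrent K a w \<longleftrightarrow> (\<forall>N. \<exists>j\<ge>N. \<forall>k<K. a (j + k) = w k)"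

lemma recurrent_cong: "(\<And>k. k < K \<Longrightarrow> w k = w' k) \<Longrightarrow> recurrent K a w \<Longrightarrow> recurrent K a w'"
  by (simp add: recurrent_def)

lemma finite_range_map_bool: "finite (range (\<lambda>i::nat. map (f i) [0..<K::nat] :: bool list))"
  by (rule finite_subset[OF _ finite_lists_length_eq[of UNIV K]]) auto

text \<open>There are only finitely many words of length \<open>K\<close>, and those that occur
  finitely often have all disappeared after some index.\<close>

lemma eventually_recurrent:
  "\<exists>n0. \<forall>i\<ge>n0. recurrent K a (\<lambda>k. a (i + k))"
proof -
  define W where "W i = map (\<lambda>k. a (i + k)) [0..<K]" for i
  have W_eq: "W i = W j \<longleftrightarrow> (\<forall>k<K. a (i + k) = a (j + k))" for i j
    by (auto simp: W_def)
  have fin: "finite (range W)" unfolding W_def by (rule finite_range_map_bool)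
  have "finite {w\<in>range W. finite (W -` {w})}" using fin by (rule rev_finite_subset) blast
  then have "finite (\<Union>w\<in>{w\<in>range W. finite (W -` {w})}. W -` {w})" by (rule finite_UN_I) simp
  moreover have "{i. finite (W -` {W i})} \<subseteq> (\<Union>w\<in>{w\<in>range W. finite (W -` {w})}. W -` {w})"
  proof
    fix i assume "i \<in> {i. finite (W -` {W i})}"
    then show "i \<in> (\<Union>w\<in>{w\<in>range W. finite (W -` {w})}. W -` {w})"
      by (intro UN_I[of "W i"]) simp_all
  qed
  ultimately have "finite {i. finite (W -` {W i})}" by (rule rev_finite_subset)
  then obtain n0 where n0: "\<And>i. i \<in> {i. finite (W -` {W i})} \<Longrightarrow> i < n0"
    unfolding finite_nat_set_iff_bounded[of "{i. finite (W -` {W i})}"] by blast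
  show ?thesis
  proof (intro exI[of _ n0] allI impI)
    fix i assume "i \<ge> n0"
    then have "infinite (W -` {W i})" using n0[of i] by force
    then have "\<forall>N. \<exists>j\<ge>N. W j = W i" by (auto simp: infinite_nat_iff_unbounded_le)
    then show "recurrent K a (\<lambda>k. a (i + k))" by (simp add: recurrent_def W_eq)
  qed
qed

text \<open>Words are read from right to left: \<open>u 0\<close> is the letter just before the current position.\<close>

definition legal :: "nat \<Rightarrow> (nat \<Rightarrow> bool) \<Rightarrow> (nat \<Rightarrow> bool) \<Rightarrow> (nat \<Rightarrow> bool) \<Rightarrow> nat \<Rightarrow> bool" where
  "legal K a v u n \<longleftrightarrow> n \<ge> K \<and> (\<forall>k<K. u k = v k) \<and>
     (\<forall>i. i + K \<le> n \<longrightarrow> recurrent K a (\<lambda>k. u (i + K - 1 - k)))"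

text \<open>The pasts of the positions in \<open>A\<close> are at least as large as every legal word, hence all agree with
  the lexicographically largest legal word \<open>\<eta>\<close>. Between two positions of \<open>A\<close> there is a loop \<open>W\<close>, and
  maximality of \<open>\<eta>\<close> against both \<open>\<eta>\<close> with \<open>W\<close> removed and \<open>\<eta>\<close> with \<open>W\<close> prepended forces
  \<open>\<eta>\<close> to be periodic.\<close>

lemma maximal_pasts_periodic:
  fixes a :: "nat \<Rightarrow> bool"
  assumes rec: "\<And>i. i \<ge> n0 \<Longrightarrow> recurrent K a (\<lambda>k. a (i + k))"
    and inf: "infinite A"
    and A_ge: "\<And>m. m \<in> A \<Longrightarrow> m \<ge> n0 + K"
    and A_v: "\<And>m k. m \<in> A \<Longrightarrow> k < K \<Longrightarrow> a (m - 1 - k) = v k"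
    and max: "\<And>u n m k. legal K a v u n \<Longrightarrow> m \<in> A \<Longrightarrow> k < n \<Longrightarrow> k < m - n0 \<Longrightarrow>
       (\<And>j. j < k \<Longrightarrow> u j = a (m - 1 - j)) \<Longrightarrow> u k \<Longrightarrow> a (m - 1 - k)"
  shows "\<exists>t>0. \<forall>i\<ge>n0. a (i + t) = a i"
proof -
  have ex_A: "\<exists>m\<in>A. m > N" for N
    using inf by (auto simp: infinite_nat_iff_unbounded)
  have legal_past: "legal K a v (\<lambda>k. a (m - 1 - k)) (m - n0)" if m: "m \<in> A" for m
    unfolding legal_def
  proof (intro conjI allI impI)
    show "K \<le> m - n0" using A_ge[OF m] by simp
    show "a (m - 1 - k) = v k" if "k < K" for k using A_v m that by blast
    show "recurrent K a (\<lambda>k. a (m - 1 - (i + K - 1 - k)))" if "i + K \<le> m - n0" for i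
    proof (rule recurrent_cong[OF _ rec[of "m - i - K"]])
      fix k assume "k < K"
      then have "m - i - K + k = m - 1 - (i + K - 1 - k)" using that A_ge[OF m] by linarith
      then show "a (m - i - K + k) = a (m - 1 - (i + K - 1 - k))" by simp
    qed (use that A_ge[OF m] in linarith)
  qed
  \<comment> \<open>Each past of a position in \<open>A\<close> is itself legal, so
    \<open>max\<close> applies in both directions at a first difference.\<close>
  have agree: "a (m - 1 - k) = a (m' - 1 - k)" if m: "m \<in> A" "m' \<in> A" and k: "k < m - n0" "k < m' - n0" for m m' k
    using k
  proof (induction k rule: less_induct)
    case (less k)
    have eq: "\<And>j. j < k \<Longrightarrow> a (m - 1 - j) = a (m' - 1 - j)" using less by auto
    show ?case
    proof
      assume "a (m - 1 - k)"
      then show "a (m' - 1 - k)"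
        using max[OF legal_past[OF m(1)] m(2) less.prems] eq by simp
    next
      assume "a (m' - 1 - k)"
      then show "a (m - 1 - k)"
        using max[OF legal_past[OF m(2)] m(1) less.prems(2,1)] eq by simp
    qed
  qed
  define M where "M k = (SOME m. m \<in> A \<and> k < m - n0)" for k
  have M: "M k \<in> A \<and> k < M k - n0" for k
    unfolding M_def
  proof (rule someI_ex)
    obtain m where "m \<in> A" "m > k + n0" using ex_A by blast
    then show "\<exists>m. m \<in> A \<and> k < m - n0" by (intro exI[of _ m]) auto
  qed
  define \<eta> where "\<eta> k = a (M k - 1 - k)" for k
  have eta: "\<eta> k = a (m - 1 - k)" if "m \<in> A" "k < m - n0" for m k
    unfolding \<eta>_def by (rule agree) (use M that in auto)
  have eta_v: "\<eta> k = v k" if "k < K" for k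
    unfolding \<eta>_def by (rule A_v) (use M that in auto)
  have eta_rec: "recurrent K a (\<lambda>k. \<eta> (i + K - 1 - k))" for i
  proof -
    obtain m where m: "m \<in> A" "m > n0 + i + K" using ex_A by blast
    have "recurrent K a (\<lambda>k. a (m - 1 - (i + K - 1 - k)))"
      using legal_past[OF m(1)] m(2) unfolding legal_def by auto
    moreover have "\<eta> (i + K - 1 - k) = a (m - 1 - (i + K - 1 - k))" for k
      by (rule eta[OF m(1)]) (use m(2) in linarith)
    ultimately show ?thesis by simp
  qed
  have eta_max: "\<eta> k" if "legal K a v u n" "k < n" "\<And>j. j < k \<Longrightarrow> u j = \<eta> j" "u k" for u n k
  proof -
    obtain m where m: "m \<in> A" "m > n0 + k" using ex_A by blast
    have "a (m - 1 - k)"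
    proof (rule max[OF that(1) m(1) that(2)])
      show "u j = a (m - 1 - j)" if "j < k" for j
        using eta[OF m(1), of j] m(2) that \<open>\<And>j. j < k \<Longrightarrow> u j = \<eta> j\<close>[OF that] by simp
      show "k < m - n0" using m by simp
      show "u k" by fact
    qed
    then show ?thesis using eta[OF m(1), of k] m(2) by simp
  qed
  obtain m where m: "m \<in> A" "m > n0 + K" using ex_A by blast
  obtain m' where m': "m' \<in> A" "m' > m + K" using ex_A by blast
  \<comment> \<open>The loop is the stretch between \<open>m\<close> and \<open>m'\<close>, read
    backwards. It is longer than \<open>K\<close>, and the same \<open>K\<close> letters
    \<open>v\<close> precede both of its ends.\<close>
  define t where "t = m' - m"
  have t: "t > K" using m' by (simp add: t_def)
  have shift_v: "\<eta> (k + t) = v k" if "k < K" for k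
  proof -
    have "\<eta> (k + t) = a (m' - 1 - (k + t))" by (rule eta[OF m'(1)]) (use m m' that in \<open>simp add: t_def\<close>)
    also have "m' - 1 - (k + t) = m - 1 - k" using m' by (simp add: t_def)
    finally show ?thesis using A_v m that by simp
  qed
  have removed: "legal K a v (\<lambda>k. \<eta> (k + t)) n" if "n \<ge> K" for n
    unfolding legal_def
  proof (intro conjI allI impI that shift_v)
    fix i
    show "recurrent K a (\<lambda>k. \<eta> (i + K - 1 - k + t))"
    proof (rule recurrent_cong[OF _ eta_rec[of "i + t"]])
      fix k assume "k < K"
      then have "i + t + K - 1 - k = i + K - 1 - k + t" by linarith
      then show "\<eta> (i + t + K - 1 - k) = \<eta> (i + K - 1 - k + t)" by simp
    qed
  qed auto
  have prepended: "legal K a v (\<lambda>k. if k < t then \<eta> k else \<eta> (k - t)) n" if "n \<ge> K" for n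
    unfolding legal_def
  proof (intro conjI allI impI that)
    fix k assume "k < K"
    then show "(if k < t then \<eta> k else \<eta> (k - t)) = v k" using t eta_v by auto
  next
    fix i
    show "recurrent K a (\<lambda>k. if i + K - 1 - k < t then \<eta> (i + K - 1 - k) else \<eta> (i + K - 1 - k - t))"
    \<comment> \<open>A window that starts inside the added copy is a window of
      \<open>\<eta>\<close>: where it runs over the end of the loop, both sequences continue with
      \<open>v\<close>.\<close>
    proof (cases "i < t")
      case True
      show ?thesis
      proof (rule recurrent_cong[OF _ eta_rec[of i]])
        fix k assume "k < K"
        show "\<eta> (i + K - 1 - k) = (if i + K - 1 - k < t then \<eta> (i + K - 1 - k) else \<eta> (i + K - 1 - k - t))"
        proof (cases "i + K - 1 - k < t")
          case False
          define r where "r = i + K - 1 - k - t"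
          have r: "r < K" "i + K - 1 - k = r + t" using False True \<open>k < K\<close> by (auto simp: r_def)
          then show ?thesis using shift_v[of r] eta_v[of r] by simp
        qed simp
      qed
    next
      case False
      show ?thesis
      proof (rule recurrent_cong[OF _ eta_rec[of "i - t"]])
        fix k assume "k < K"
        then have "i - t + K - 1 - k = i + K - 1 - k - t" "\<not> i + K - 1 - k < t" using False by linarith+
        then show "\<eta> (i - t + K - 1 - k) = (if i + K - 1 - k < t then \<eta> (i + K - 1 - k) else \<eta> (i + K - 1 - k - t))"
          by (simp only: if_False)
      qed
    qed
  qed
  \<comment> \<open>The word with the loop removed shows that \<open>\<eta> (k + t)\<close> implies
    \<open>\<eta> k\<close>; the word with the loop repeated gives the converse. Before that index
    both agree with \<open>\<eta>\<close> by induction.\<close>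
  have per: "\<eta> (k + t) = \<eta> k" for k
  proof (induction k rule: less_induct)
    case (less k)
    show ?case
    proof
      assume "\<eta> (k + t)"
      moreover have "legal K a v (\<lambda>k. \<eta> (k + t)) (k + K + 1)" by (rule removed) simp
      ultimately show "\<eta> k" using eta_max[of "\<lambda>k. \<eta> (k + t)" "k + K + 1" k] less by simp
    next
      assume k: "\<eta> k"
      let ?u = "\<lambda>k. if k < t then \<eta> k else \<eta> (k - t)"
      show "\<eta> (k + t)"
      proof (rule eta_max[OF prepended[of "k + t + K + 1"]])
        fix j assume j: "j < k + t"
        show "?u j = \<eta> j"
        proof (cases "j < t")
          case False
          then have "j - t < k" "j - t + t = j" using j by auto
          then show ?thesis using less[of "j - t"] False by simp
        qed simp
      qed (use k in auto)
    qed
  qed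
  have "a (i + t) = a i" if "i \<ge> n0" for i
  proof -
    obtain l where l: "l \<in> A" "l > i + t + 1" using ex_A by blast
    have "l - 1 - i < l - n0" "l - 1 - (l - 1 - i) = i" using l that by linarith+
    then have "a i = \<eta> (l - 1 - i)" using eta[OF l(1)] by metis
    moreover have "l - 1 - (i + t) < l - n0" "l - 1 - (l - 1 - (i + t)) = i + t" using l that by linarith+
    then have "a (i + t) = \<eta> (l - 1 - (i + t))" using eta[OF l(1)] by metis
    moreover have "l - 1 - i = l - 1 - (i + t) + t" using l by linarith
    ultimately show ?thesis using per[of "l - 1 - (i + t)"] by simp
  qed
  then show ?thesis using t by (intro exI[of _ t]) auto
qed

section \<open>Closing words in the presence of a gap\<close>

lemma map_upt_eqI: "(\<And>i. i < l \<Longrightarrow> f (a + i) = g (b + i)) \<Longrightarrow> map f [a..<a + l] = map g [b..<b + l]"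
  by (rule nth_equalityI) auto

lemma past_eq_act_rev:
  assumes "k \<le> n"
  shows "past x n = act (map (\<lambda>j. letter x (n - 1 - j)) [0..<k]) (past x (n - k))"
proof -
  have "rev (map (letter x) [n - k..<n - k + k]) = map (\<lambda>j. letter x (n - 1 - j)) [0..<k]"
    using assms by (intro nth_equalityI) (auto simp: rev_nth intro!: arg_cong[of _ _ "letter x"])
  then show ?thesis using past_eq_act[of x "n - k" k] assms by simp
qed

lemma act_replicate_True: "act (replicate k True) y = real k + y"
  by (induction k) (simp_all add: step_def)

text \<open>A run of \<open>k\<close> letters \<open>True\<close> makes the orbit at its beginning
  exceed \<open>k\<close>.\<close>

lemma bounded_height_ex_not_letter:
  assumes x: "x > 0" "x \<notin> \<rat>" and h: "height x i \<le> C" and k: "real k > C"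
  shows "\<exists>j\<in>{i..<i+k}. \<not> letter x j"
proof (rule ccontr)
  assume "\<not> ?thesis"
  then have "map (letter x) [i..<i+k] = replicate k True"
    by (intro nth_equalityI) auto
  then have "orbit x i = real k + orbit x (i + k)"
    using orbit_eq_act[OF x, of i k] act_replicate_True by simp
  moreover have "orbit x i \<le> height x i" using past_pos[of x i] by (simp add: height_def)
  ultimately show False using h k orbit_pos[OF x, of "i + k"] by linarith
qed

lemma bounded_height_both_letters:
  assumes x: "x > 0" "x \<notin> \<rat>" and h: "height x i \<le> C" and k: "real k > C"
  shows "(\<exists>j\<in>{i..<i+k}. letter x j) \<and> (\<exists>j\<in>{i..<i+k}. \<not> letter x j)"
proof -
  have "1 / x > 0" "1 / x \<notin> \<rat>"
    using x Rats_inverse[of "1 / x"] by (auto simp: inverse_eq_divide)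
  then have "\<exists>j\<in>{i..<i+k}. \<not> letter (1 / x) j"
    using h k inverse_orbit_past(3)[OF x] by (intro bounded_height_ex_not_letter) auto
  then show ?thesis
    using bounded_height_ex_not_letter[OF x h k] inverse_orbit_past(2)[OF x] by auto
qed

text \<open>Around \<open>n\<close> the word of \<open>x'\<close> has the same \<open>L\<close>
  letters on either side as some late position of \<open>x\<close>. By contraction each of the four
  terms in \<open>height\<close> changes by less than \<open>\<delta>\<close>, and two of them are
  added.\<close>

lemma recurrent_windows_height:
  assumes x: "x > 0" "x \<notin> \<rat>" and x': "x' > 0" "x' \<notin> \<rat>"
    and k: "k > 0" and good: "\<And>i. i \<ge> N \<Longrightarrow> (\<exists>j\<in>{i..<i+k}. letter x j) \<and> (\<exists>j\<in>{i..<i+k}. \<not> letter x j)"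
    and h: "\<And>n. n \<ge> N \<Longrightarrow> height x n \<le> C"
    and L: "\<And>xs y z. mixed k xs \<Longrightarrow> length xs \<ge> L \<Longrightarrow> y > 0 \<Longrightarrow> z > 0 \<Longrightarrow>
      \<bar>act xs y - act xs z\<bar> < \<delta> \<and> \<bar>1 / act xs y - 1 / act xs z\<bar> < \<delta>"
    and rec: "\<And>i. recurrent (2 * L) (letter x) (\<lambda>j. letter x' (i + j))"
    and n: "n \<ge> L"
  shows "height x' n \<le> C + 2 * \<delta>"
proof -
  obtain j where j: "j \<ge> N" "\<And>i. i < 2 * L \<Longrightarrow> letter x (j + i) = letter x' (n - L + i)"
    using rec[of "n - L"] unfolding recurrent_def by blast
  let ?R = "map (letter x) [j + L..<j + L + L]" and ?P = "rev (map (letter x) [j..<j + L])"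
  have "map (letter x') [n..<n + L] = ?R"
  proof (rule map_upt_eqI)
    fix i assume "i < L"
    then show "letter x' (n + i) = letter x (j + L + i)"
      using j(2)[of "L + i"] n by (simp add: add.assoc)
  qed
  then have o: "orbit x' n = act ?R (orbit x' (n + L))" using orbit_eq_act[OF x', of n L] by simp
  have "map (letter x') [n - L..<n - L + L] = map (letter x) [j..<j + L]"
    using j(2) by (intro map_upt_eqI) auto
  then have p: "past x' n = act ?P (past x' (n - L))" using past_eq_act[of x' "n - L" L] n by simp
  have mR: "mixed k ?R" using j(1) k by (intro mixed_mapI good) auto
  have mP: "mixed k ?P" using j(1) k by (intro mixed_rev mixed_mapI good) auto
  have "\<bar>orbit x' n - orbit x (j + L)\<bar> < \<delta> \<and> \<bar>1 / orbit x' n - 1 / orbit x (j + L)\<bar> < \<delta>"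
    unfolding o using orbit_eq_act[OF x, of "j + L" L] L[OF mR] orbit_pos[OF x] orbit_pos[OF x'] by simp
  moreover have "\<bar>past x' n - past x (j + L)\<bar> < \<delta> \<and> \<bar>1 / past x' n - 1 / past x (j + L)\<bar> < \<delta>"
    unfolding p using past_eq_act[of x j L] L[OF mP] past_pos by simp
  moreover have "height x (j + L) \<le> C" using h j(1) by simp
  ultimately show ?thesis unfolding height_def by linarith
qed

text \<open>One period of \<open>c\<close> is \<open>u\<close> read forwards, then \<open>la\<close>
  from \<open>m\<close> up to \<open>j - 1\<close>. At the first seam \<open>u\<close> ends in the
  same \<open>K\<close> letters as the past of \<open>m\<close>; at the second, \<open>la\<close>
  continues from \<open>j\<close> with the beginning of \<open>u\<close>. So every window comes from
  \<open>u\<close> or from \<open>la\<close>.\<close>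

lemma closing_word_recurrent:
  fixes la :: "nat \<Rightarrow> bool"
  assumes rec: "\<And>i. i \<ge> n0 \<Longrightarrow> recurrent K la (\<lambda>k. la (i + k))"
    and legal: "legal K la v u n"
    and m: "m \<ge> n0 + K" "\<And>k. k < K \<Longrightarrow> la (m - 1 - k) = v k"
    and j: "j > m" "\<And>i. i < K \<Longrightarrow> la (j + i) = u (n - 1 - i)"
    and T: "T = n + (j - m)"
    and c: "\<And>i. c i = (if i mod T < n then u (n - 1 - i mod T) else la (m + i mod T - n))"
  shows "recurrent K la (\<lambda>k. c (i + k))"
proof -
  \<comment> \<open>One period that runs on along \<open>la\<close> past \<open>j\<close> instead of
    wrapping round; by the choice of \<open>j\<close> the two agree on all windows of length
    \<open>K\<close> that start in the period.\<close>
  let ?d = "\<lambda>i. if i < n then u (n - 1 - i) else la (m + i - n)"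
  define r where "r = i mod T"
  have nK: "n \<ge> K" using legal by (simp add: legal_def)
  have TK: "T > n" using j T by simp
  have r: "r < T" using TK by (simp add: r_def)
  have cd: "c (i + k) = ?d (r + k)" if "k < K" for k
  proof -
    have md: "(i + k) mod T = (r + k) mod T" by (simp add: r_def mod_add_left_eq)
    show ?thesis
    proof (cases "r + k < T")
      case True
      then have "(i + k) mod T = r + k" using md by simp
      then show ?thesis by (simp add: c)
    next
      case False
      define s where "s = r + k - T"
      have s: "r + k = T + s" "s < K" "s < T" using False that r nK TK by (auto simp: s_def)
      then have "(i + k) mod T = s" using md by simp
      then have "c (i + k) = u (n - 1 - s)" using s nK by (simp add: c)
      also have "\<dots> = la (j + s)" using j s by simp
      also have "j + s = m + (r + k) - n" using s(1) T j by simp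
      finally show ?thesis using s TK by simp
    qed
  qed
  have "recurrent K la (\<lambda>k. ?d (r + k))"
  proof (cases "r + K \<le> n")
    case True
    have "recurrent K la (\<lambda>k. u (n - r - K + K - 1 - k))"
      using legal True unfolding legal_def by (metis diff_le_self le_add_diff_inverse2 diff_diff_left le_diff_conv)
    then show ?thesis
    proof (rule recurrent_cong[rotated])
      fix k assume "k < K"
      then have "n - r - K + K - 1 - k = n - 1 - (r + k)" "r + k < n" using True by linarith+
      then show "u (n - r - K + K - 1 - k) = ?d (r + k)" by (simp only: if_True)
    qed
  next
    case False
    have ge: "m + r - n \<ge> n0" using m(1) False by linarith
    show ?thesis
    proof (rule recurrent_cong[OF _ rec[OF ge]])
      fix k assume "k < K"
      show "la (m + r - n + k) = ?d (r + k)"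
      proof (cases "r + k < n")
        case True
        define s where "s = n - 1 - (r + k)"
        have s: "s < K" "m + r - n + k = m - 1 - s" using True False m(1) by (auto simp: s_def)
        have "u s = v s" using legal s unfolding legal_def by blast
        then have "la (m + r - n + k) = u (n - 1 - (r + k))" using s m(2)[of s] s_def by metis
        then show ?thesis using True by simp
      next
        case False2: False
        then have "m + r - n + k = m + (r + k) - n" using False m(1) by linarith
        then show ?thesis using False2 by simp
      qed
    qed
  qed
  then show ?thesis by (rule recurrent_cong[rotated]) (simp add: cd)
qed

text \<open>If a legal word beat the past of a position in \<open>A\<close>, closing it up would
  give a periodic word with heights eventually at most \<open>a + \<epsilon>\<close>, hence by the
  gap below every \<open>a + \<delta>\<close>. Yet at the copies of that position the height exceeds
  \<open>a\<close> by a fixed amount. So the hypothesis \<open>max\<close> of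
  \<open>maximal_pasts_periodic\<close> holds.\<close>

lemma gap_imp_eventually_periodic:
  assumes x: "x > 0" "x \<notin> \<rat>" and \<epsilon>: "\<epsilon> > 0"
    and gap: "\<And>x' \<delta>. x' > 0 \<Longrightarrow> x' \<notin> \<rat> \<Longrightarrow> \<exists>N. \<forall>n\<ge>N. height x' n \<le> a + \<epsilon> \<Longrightarrow> \<delta> > 0 \<Longrightarrow>
      \<exists>N. \<forall>n\<ge>N. height x' n < a + \<delta>"
    and up: "\<And>\<delta>. \<delta> > 0 \<Longrightarrow> \<exists>N. \<forall>n\<ge>N. height x n < a + \<delta>"
    and often: "\<And>N. \<exists>n\<ge>N. orbit x n + past x n \<ge> a"
  shows "\<exists>n0. \<exists>t>0. \<forall>i\<ge>n0. letter x (i + t) = letter x i"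
proof -
  let ?la = "letter x"
  \<comment> \<open>The margin \<open>\<epsilon>\<close> is spent as \<open>\<epsilon> / 2\<close>
    on the heights of \<open>x\<close> and twice \<open>\<epsilon> / 4\<close> on the comparison of
    windows.\<close>
  obtain N where N: "\<And>n. n \<ge> N \<Longrightarrow> height x n < a + \<epsilon> / 2"
    using up[of "\<epsilon> / 2"] \<epsilon> by auto
  obtain k where k: "real k > max 0 (a + \<epsilon> / 2)" using reals_Archimedean2 by blast
  then have k0: "k > 0" by auto
  have good: "(\<exists>j\<in>{i..<i+k}. ?la j) \<and> (\<exists>j\<in>{i..<i+k}. \<not> ?la j)" if "i \<ge> N" for i
    using N[OF that] k by (intro bounded_height_both_letters[OF x, where C = "a + \<epsilon> / 2"]) auto
  obtain L0 where L0: "\<And>xs y z. mixed k xs \<Longrightarrow> length xs \<ge> L0 \<Longrightarrow> y > 0 \<Longrightarrow> z > 0 \<Longrightarrow>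
    \<bar>act xs y - act xs z\<bar> < \<epsilon> / 4 \<and> \<bar>1 / act xs y - 1 / act xs z\<bar> < \<epsilon> / 4"
    using mixed_contract_both[of "\<epsilon> / 4" k] \<epsilon> by auto
  \<comment> \<open>\<open>L \<ge> k\<close> ensures that late windows of length \<open>K\<close>
    contain both letters, so both occur infinitely often in the closed word.\<close>
  define L where "L = max L0 k"
  have L: "\<bar>act xs y - act xs z\<bar> < \<epsilon> / 4 \<and> \<bar>1 / act xs y - 1 / act xs z\<bar> < \<epsilon> / 4"
    if "mixed k xs" "length xs \<ge> L" "y > 0" "z > 0" for xs y z
    using that L0 by (simp add: L_def)
  define K where "K = 2 * L"
  have kK: "k \<le> K" by (simp add: K_def L_def)
  obtain n1 where n1: "\<And>i. i \<ge> n1 \<Longrightarrow> recurrent K ?la (\<lambda>k. ?la (i + k))"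
    using eventually_recurrent by blast
  define n0 where "n0 = max N n1"
  have rec: "recurrent K ?la (\<lambda>k. ?la (i + k))" if "i \<ge> n0" for i
    using that n1 by (simp add: n0_def)
  let ?A0 = "{m. m \<ge> n0 + K \<and> orbit x m + past x m \<ge> a}"
  let ?f = "\<lambda>m. map (\<lambda>k. ?la (m - 1 - k)) [0..<K]"
  have "infinite ?A0"
    unfolding infinite_nat_iff_unbounded_le
  proof
    fix M
    obtain n where "n \<ge> max M (n0 + K)" "orbit x n + past x n \<ge> a" using often by blast
    then show "\<exists>n\<ge>M. n \<in> ?A0" by auto
  qed
  moreover have "finite (?f ` ?A0)"
    by (rule finite_subset[OF _ finite_range_map_bool[of "\<lambda>m k. ?la (m - 1 - k)" K]]) auto
  \<comment> \<open>Pigeonhole: infinitely many positions share their \<open>K\<close> preceding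
    letters, which become \<open>v\<close>.\<close>
  ultimately obtain m0 where m0: "infinite {m \<in> ?A0. ?f m = ?f m0}"
    using pigeonhole_infinite[of ?A0 ?f] by blast
  define A where "A = {m \<in> ?A0. ?f m = ?f m0}"
  have infA: "infinite A" unfolding A_def by (fact m0)
  define v where "v k = ?la (m0 - 1 - k)" for k
  have A: "m \<ge> n0 + K" "orbit x m + past x m \<ge> a" "\<And>k. k < K \<Longrightarrow> ?la (m - 1 - k) = v k" if "m \<in> A" for m
    using that by (auto simp: A_def v_def)
  have "\<exists>t>0. \<forall>i\<ge>n0. ?la (i + t) = ?la i"
  proof (rule maximal_pasts_periodic[where A = A and K = K and v = v])
    fix u n m q
    assume legal: "legal K ?la v u n" and m: "m \<in> A" and q: "q < n" "q < m - n0"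
      and pre: "\<And>j. j < q \<Longrightarrow> u j = ?la (m - 1 - j)" and uq: "u q"
    have nK: "n \<ge> K" using legal by (simp add: legal_def)
    show "?la (m - 1 - q)"
    proof (rule ccontr)
      assume not_q: "\<not> ?la (m - 1 - q)"
      let ?U = "map u [0..<q]"
      have "past x m = act (map (\<lambda>j. ?la (m - 1 - j)) [0..<Suc q]) (past x (m - Suc q))"
        by (rule past_eq_act_rev) (use q in simp)
      also have "map (\<lambda>j. ?la (m - 1 - j)) [0..<Suc q] = ?U @ [False]"
        using pre not_q by simp
      finally have past_m: "past x m = act ?U (step False (past x (m - Suc q)))" by simp
      have P: "past x (m - Suc q) > 0" by (rule past_pos)
      have "step False (past x (m - Suc q)) < 1" using P by (simp add: step_def)
      moreover have "step False (past x (m - Suc q)) \<ge> 0" using P by (simp add: step_nonneg)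
      ultimately have "act ?U (step False (past x (m - Suc q))) < act ?U 1"
        by (intro act_strict_mono)
      then have less: "past x m < act ?U 1" using past_m by simp
      \<comment> \<open>Turning the letter at \<open>q\<close> from \<open>False\<close> to
        \<open>True\<close> moves the inner value from below 1 to above 1, so the past grows by at
        least this amount, whatever the earlier letters are.\<close>
      define \<delta> where "\<delta> = act ?U 1 - past x m"
      have \<delta>: "\<delta> > 0" using less by (simp add: \<delta>_def)
      obtain l where l: "\<And>xs y z. mixed k xs \<Longrightarrow> length xs \<ge> l \<Longrightarrow> y > 0 \<Longrightarrow> z > 0 \<Longrightarrow> \<bar>act xs y - act xs z\<bar> < \<delta> / 2"
        using mixed_contract[of "\<delta> / 2" k] \<delta> by auto
      have "recurrent K ?la (\<lambda>k. u (n - K + K - 1 - k))"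
        using legal nK unfolding legal_def by (metis le_add_diff_inverse2 order_refl)
      \<comment> \<open>The initial \<open>K\<close> letters of \<open>u\<close> in reading order
        recur in \<open>?la\<close>. Taking \<open>j\<close> beyond \<open>m + l\<close> lets the
        closed word copy \<open>l\<close> letters of the future of \<open>m\<close>.\<close>
      then obtain j where j: "j \<ge> m + l + 1" "\<And>i. i < K \<Longrightarrow> ?la (j + i) = u (n - 1 - i)"
        unfolding recurrent_def using nK by (metis le_add_diff_inverse2)
      define T where "T = n + (j - m)"
      define c where "c i = (if i mod T < n then u (n - 1 - i mod T) else ?la (m + i mod T - n))" for i
      have rec_c: "recurrent K ?la (\<lambda>k. c (i + k))" for i
        by (rule closing_word_recurrent[OF rec legal A(1)[OF m] A(3)[OF m] _ j(2) T_def c_def])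
           (use j in auto)
      have both: "(\<exists>i\<ge>M. c i) \<and> (\<exists>i\<ge>M. \<not> c i)" for M
      proof -
        obtain i where i: "i \<ge> N" "\<And>q. q < K \<Longrightarrow> ?la (i + q) = c (M + q)"
          using rec_c[of M] unfolding recurrent_def by blast
        obtain i1 i2 where i12: "i1 \<in> {i..<i+k}" "?la i1" "i2 \<in> {i..<i+k}" "\<not> ?la i2"
          using good[OF i(1)] by blast
        then have "i1 - i < K" "i + (i1 - i) = i1" "i2 - i < K" "i + (i2 - i) = i2" using kK by auto
        then have "c (M + (i1 - i))" "\<not> c (M + (i2 - i))"
          using i(2)[of "i1 - i"] i(2)[of "i2 - i"] i12 by simp_all
        then show ?thesis by (meson le_add1)
      qed
      obtain x' where x': "x' > 0" "x' \<notin> \<rat>" and lx': "letter x' = c"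
        using ex_orbit_with_letters[of c] both by blast
      have "height x' n \<le> a + \<epsilon> / 2 + 2 * (\<epsilon> / 4)" if "n \<ge> L" for n
        using x x' k0 good _ L _ that
      proof (rule recurrent_windows_height)
        show "height x n \<le> a + \<epsilon> / 2" if "n \<ge> N" for n using N[OF that] by simp
        show "recurrent (2 * L) ?la (\<lambda>j. letter x' (i + j))" for i
          using rec_c[of i] by (simp add: lx' K_def)
      qed
      then have "\<exists>N. \<forall>n\<ge>N. height x' n \<le> a + \<epsilon>" by (intro exI[of _ L]) (auto simp: add.commute)
      then obtain N1 where N1: "\<And>n. n \<ge> N1 \<Longrightarrow> height x' n < a + \<delta> / 2"
        using gap[OF x', of "\<delta> / 2"] \<delta> by auto
      \<comment> \<open>A late copy of \<open>m\<close>: the letters before \<open>s\<close> are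
        those of \<open>u\<close>, and the letters from \<open>s\<close> on are those from
        \<open>m\<close> on.\<close>
      define s where "s = n + N1 * T"
      have T: "T > n + l" using j by (simp add: T_def)
      then have "N1 * 1 \<le> N1 * T" by (intro mult_le_mono2) simp
      then have sN: "s \<ge> N1" unfolding s_def by linarith
      have "map c [s..<s + l] = map ?la [m..<m + l]"
      proof (rule map_upt_eqI)
        fix i assume "i < l"
        then have "n + i < T" "s + i = n + i + N1 * T" using T by (auto simp: s_def)
        then have "(s + i) mod T = n + i" by (simp only: mod_mult_self1 mod_less)
        then show "c (s + i) = ?la (m + i)" by (simp add: c_def)
      qed
      then have "orbit x' s = act (map ?la [m..<m + l]) (orbit x' (s + l))"
        using orbit_eq_act[OF x', of s l] lx' by simp
      moreover have "mixed k (map ?la [m..<m + l])"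
        using A(1)[OF m] k0 by (intro mixed_mapI good) (auto simp: n0_def)
      ultimately have o: "\<bar>orbit x' s - orbit x m\<bar> < \<delta> / 2"
        using orbit_eq_act[OF x, of m l] l[of "map ?la [m..<m + l]"] orbit_pos[OF x] orbit_pos[OF x'] by simp
      have "c (s - 1 - i) = u i" if "i \<le> q" for i
      proof -
        have "s - 1 - i = (n - 1 - i) + N1 * T" using that q by (simp add: s_def)
        then have "(s - 1 - i) mod T = n - 1 - i" using T by simp
        then show ?thesis using that q by (simp add: c_def)
      qed
      then have U: "map (\<lambda>i. letter x' (s - 1 - i)) [0..<Suc q] = ?U @ [True]"
        using uq lx' by simp
      have "past x' s = act (map (\<lambda>i. letter x' (s - 1 - i)) [0..<Suc q]) (past x' (s - Suc q))"
        by (rule past_eq_act_rev) (use q in \<open>simp add: s_def\<close>)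
      also have "\<dots> = act ?U (step True (past x' (s - Suc q)))" unfolding U by simp
      also have "\<dots> \<ge> act ?U 1"
        using past_pos[of x' "s - Suc q"] by (intro act_mono) (auto simp: step_def)
      finally have "past x' s \<ge> past x m + \<delta>" by (simp add: \<delta>_def)
      then have "orbit x' s + past x' s > a + \<delta> / 2" using o A(2)[OF m] by linarith
      moreover have "height x' s \<ge> orbit x' s + past x' s" by (simp add: height_def)
      ultimately show False using N1[OF sN] by linarith
    qed
  qed (use rec infA A in auto)
  then show ?thesis by blast
qed

section \<open>Left endpoints of gaps\<close>

lemma farey_denominator_sum_strict_mono:
  assumes "\<alpha> \<notin> \<rat>" "n < m" "farey \<alpha> n = (p, q, p', q')" "farey \<alpha> m = (P, Q, P', Q')"
  shows "q + q' < Q + Q'"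
proof -
  define S where "S n = (case farey \<alpha> n of (p, q, p', q') \<Rightarrow> q + q')" for n
  have "S n < S (Suc n)" for n
    using farey_invariant(2,3)[OF assms(1), of n] by (cases "farey \<alpha> n") (fastforce simp: S_def)
  then have "S n < S m" using assms(2) by (rule lift_Suc_mono_less)
  then show ?thesis using assms(3,4) by (simp add: S_def)
qed

text \<open>Periodicity and contraction identify the orbit values at \<open>n\<close> and
  \<open>n + t\<close>; written as error ratios they give a quadratic equation. If its leading
  coefficient vanished, \<open>q' / q\<close> and \<open>Q' / Q\<close> would be the same reduced
  fraction, against the growth of \<open>q + q'\<close>.\<close>

lemma periodic_letters_imp_quadratic:
  assumes irr: "\<alpha> \<notin> \<rat>" and t: "t > 0"
    and per: "\<And>i. i \<ge> n0 \<Longrightarrow> letter (start \<alpha>) (i + t) = letter (start \<alpha>) i"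
    and h: "\<And>n. n \<ge> N \<Longrightarrow> height (start \<alpha>) n \<le> C"
  shows "quadratic_irrational \<alpha>"
proof -
  let ?x = "start \<alpha>"
  note x = start_pos_irrational[OF irr]
  define n where "n = max n0 N"
  obtain k where k: "real k > max 0 C" using reals_Archimedean2 by blast
  then have k0: "k > 0" by auto
  have good: "(\<exists>j\<in>{i..<i+k}. letter ?x j) \<and> (\<exists>j\<in>{i..<i+k}. \<not> letter ?x j)" if "i \<ge> N" for i
    using h[OF that] k by (intro bounded_height_both_letters[OF x, where C = C]) auto
  have close: "\<bar>orbit ?x n - orbit ?x (n + t)\<bar> < \<delta>" if \<delta>: "\<delta> > 0" for \<delta>
  proof -
    obtain l where l: "\<And>xs y z. mixed k xs \<Longrightarrow> length xs \<ge> l \<Longrightarrow> y > 0 \<Longrightarrow> z > 0 \<Longrightarrow> \<bar>act xs y - act xs z\<bar> < \<delta>"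
      using mixed_contract[OF \<delta>, of k] by blast
    let ?xs = "map (letter ?x) [n..<n + l]"
    have "map (letter ?x) [n + t..<n + t + l] = ?xs"
    proof (rule map_upt_eqI)
      fix i
      show "letter ?x (n + t + i) = letter ?x (n + i)"
        using per[of "n + i"] by (simp add: n_def add.commute add.left_commute)
    qed
    then have "orbit ?x (n + t) = act ?xs (orbit ?x (n + t + l))"
      using orbit_eq_act[OF x, of "n + t" l] by simp
    moreover have "orbit ?x n = act ?xs (orbit ?x (n + l))" by (rule orbit_eq_act[OF x])
    moreover have "mixed k ?xs" using k0 by (intro mixed_mapI good) (auto simp: n_def)
    ultimately show ?thesis using l[of ?xs] orbit_pos[OF x] by simp
  qed
  have eq: "orbit ?x n = orbit ?x (n + t)"
  proof (rule ccontr)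
    assume "orbit ?x n \<noteq> orbit ?x (n + t)"
    then show False using close[of "\<bar>orbit ?x n - orbit ?x (n + t)\<bar>"] by simp
  qed
  obtain p q p' q' where f: "farey \<alpha> n = (p, q, p', q')" by (metis prod_cases4)
  obtain P Q P' Q' where F: "farey \<alpha> (n + t) = (P, Q, P', Q')" by (metis prod_cases4)
  note i = farey_invariant[OF irr f] and I = farey_invariant[OF irr F]
  have "(of_int q' * \<alpha> - of_int p') * (of_int P - of_int Q * \<alpha>)
    = (of_int Q' * \<alpha> - of_int P') * (of_int p - of_int q * \<alpha>)"
    using eq i I by (simp add: frac_eq_eq)
  then have "real_of_int (Q' * q - q' * Q) * \<alpha>\<^sup>2 + real_of_int (q' * P + p' * Q - Q' * p - P' * q) * \<alpha>
    + real_of_int (P' * p - p' * P) = 0"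
    by (simp add: algebra_simps power2_eq_square)
  moreover have "Q' * q - q' * Q \<noteq> 0"
  proof
    assume "Q' * q - q' * Q = 0"
    then have e: "Q' * q = q' * Q" by simp
    have "coprime q q'"
    proof (rule coprimeI)
      fix c assume "c dvd q" "c dvd q'"
      then have "c dvd p * q' - p' * q" by simp
      then show "is_unit c" using i by simp
    qed
    moreover have "coprime Q Q'"
    proof (rule coprimeI)
      fix c assume "c dvd Q" "c dvd Q'"
      then have "c dvd P * Q' - P' * Q" by simp
      then show "is_unit c" using I by simp
    qed
    moreover have "q dvd q' * Q" "Q dvd Q' * q" using e by (metis dvd_triv_right)+
    ultimately have "q dvd Q" "Q dvd q" by (simp_all add: coprime_dvd_mult_right_iff)
    then have "q = Q" using i I by (intro zdvd_antisym_nonneg) auto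
    moreover from this have "q' = Q'" using e I by simp
    ultimately show False using farey_denominator_sum_strict_mono[OF irr _ f F] t by simp
  qed
  ultimately show ?thesis unfolding quadratic_irrational_def using irr by blast
qed

section \<open>Lagrange constants and gaps in terms of heights\<close>

lemma lagrange_const_ge_1:
  assumes "\<alpha> \<notin> \<rat>"
  shows "lagrange_const \<alpha> \<ge> 1"
proof -
  have "approximable \<alpha> (1 / 1)"
    using approximable_iff_height[OF assms, of 1] height_ge_1[OF start_pos_irrational[OF assms]] by auto
  then show ?thesis using approximable_imp_lagrange_const_ge[of \<alpha> 1] by (simp add: one_ereal_def)
qed

lemma lagrange_const_le_imp_height:
  assumes "\<alpha> \<notin> \<rat>" "lagrange_const \<alpha> \<le> ereal a" "a > 0" "\<delta> > 0"
  shows "\<exists>N. \<forall>n\<ge>N. height (start \<alpha>) n < a + \<delta>"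
proof (rule ccontr)
  assume "\<not> ?thesis"
  then have "\<forall>N. \<exists>n\<ge>N. height (start \<alpha>) n \<ge> a + \<delta>" by (auto simp: not_less)
  then have "approximable \<alpha> (1 / (a + \<delta>))" using approximable_iff_height[OF assms(1)] assms by simp
  then have "lagrange_const \<alpha> \<ge> ereal (a + \<delta>)"
    using assms by (intro approximable_imp_lagrange_const_ge) auto
  then have "ereal (a + \<delta>) \<le> ereal a" using assms(2) by (rule order_trans)
  then show False using assms by simp
qed

lemma height_imp_lagrange_const_le:
  assumes "\<alpha> \<notin> \<rat>" "\<forall>n\<ge>N. height (start \<alpha>) n \<le> a" "a > 0"
  shows "lagrange_const \<alpha> \<le> ereal a"
proof (rule ccontr)
  assume "\<not> ?thesis"
  then obtain c where c: "ereal a < ereal c" "ereal c < lagrange_const \<alpha>"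
    using ereal_dense2 by (metis not_le)
  then have "approximable \<alpha> (1 / c)" using assms by (intro lagrange_const_gt_imp_approximable) auto
  then obtain n where "n \<ge> N" "height (start \<alpha>) n \<ge> c"
    using approximable_iff_height[OF assms(1), of c] c assms by auto
  then show False using assms c by force
qed

lemma attainable_gap_imp_quadratic:
  assumes gap: "maximal_gap (ereal a) b" and att: "attainable \<alpha>" and a: "lagrange_const \<alpha> = ereal a"
  shows "quadratic_irrational \<alpha>"
proof -
  have irr: "\<alpha> \<notin> \<rat>" using att by (simp add: attainable_def)
  have "ereal a \<ge> 1" using lagrange_const_ge_1[OF irr] a by simp
  then have a0: "a > 0" by (simp add: one_ereal_def)
  \<comment> \<open>A real number inside the gap is chosen because \<open>b\<close> may be
    infinite.\<close>
  obtain e where e: "ereal a < ereal e" "ereal e < b"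
    using gap ereal_dense2 unfolding maximal_gap_def by blast
  define \<epsilon> where "\<epsilon> = e - a"
  have \<epsilon>: "\<epsilon> > 0" "ereal (a + \<epsilon>) < b" using e by (auto simp: \<epsilon>_def)
  let ?x = "start \<alpha>"
  note x = start_pos_irrational[OF irr]
  \<comment> \<open>Every positive irrational \<open>x'\<close> is the \<open>start\<close> of
    \<open>x' / (1 + x')\<close>, so the emptiness of the gap becomes a statement about
    heights.\<close>
  have gap': "\<exists>N. \<forall>n\<ge>N. height x' n < a + \<delta>"
    if x': "x' > 0" "x' \<notin> \<rat>" and h: "\<exists>N. \<forall>n\<ge>N. height x' n \<le> a + \<epsilon>" and \<delta>: "\<delta> > 0" for x' \<delta>
  proof -
    let ?\<beta> = "x' / (1 + x')"
    have start: "start ?\<beta> = x'" using start_of_orbit[OF x'(1)] .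
    have "1 - ?\<beta> = 1 / (1 + x')" using x' by (simp add: field_simps)
    then have "x' = ?\<beta> / (1 - ?\<beta>)" using x' by simp
    then have irr': "?\<beta> \<notin> \<rat>" using x'(2) by (metis Rats_1 Rats_diff Rats_divide)
    obtain N where "\<forall>n\<ge>N. height (start ?\<beta>) n \<le> a + \<epsilon>" using h start by auto
    then have "lagrange_const ?\<beta> \<le> ereal (a + \<epsilon>)"
      using height_imp_lagrange_const_le[OF irr'] a0 \<epsilon> by simp
    then have "lagrange_const ?\<beta> < b" using \<epsilon>(2) by (rule le_less_trans)
    moreover have "lagrange_const ?\<beta> \<in> lagrange_spectrum" using irr' by (auto simp: lagrange_spectrum_def)
    ultimately have "lagrange_const ?\<beta> \<le> ereal a"
      using gap unfolding maximal_gap_def by (meson disjoint_iff greaterThanLessThan_iff not_le)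
    then show ?thesis using lagrange_const_le_imp_height[OF irr' _ a0 \<delta>] start by simp
  qed
  have up: "\<exists>N. \<forall>n\<ge>N. height ?x n < a + \<delta>" if "\<delta> > 0" for \<delta>
    using lagrange_const_le_imp_height[OF irr _ a0 that] a by simp
  have inf: "\<exists>n\<ge>N. height ?x n \<ge> a" for N
    using att attainable_iff_approximable[OF a a0] approximable_iff_height[OF irr a0] by blast
  have "\<exists>n0. \<exists>t>0. \<forall>i\<ge>n0. letter ?x (i + t) = letter ?x i"
  \<comment> \<open>Heights of at least \<open>a\<close> come infinitely often from one of the two
    columns; inversion reduces the second column to the first.\<close>
  proof (cases "\<forall>N. \<exists>n\<ge>N. orbit ?x n + past ?x n \<ge> a")
    case True
    then show ?thesis using gap_imp_eventually_periodic[OF x \<epsilon>(1) gap' up] by blast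
  next
    case False
    then obtain N0 where N0: "\<And>n. n \<ge> N0 \<Longrightarrow> \<not> orbit ?x n + past ?x n \<ge> a" by blast
    note inv = inverse_orbit_past[OF x]
    have y: "1 / ?x > 0" "1 / ?x \<notin> \<rat>"
      using x Rats_inverse[of "1 / ?x"] by (auto simp: inverse_eq_divide)
    have "\<exists>n\<ge>N. orbit (1 / ?x) n + past (1 / ?x) n \<ge> a" for N
    proof -
      obtain n where n: "n \<ge> max N N0" "height ?x n \<ge> a" using inf by blast
      then have "1 / orbit ?x n + 1 / past ?x n \<ge> a" using N0[of n] by (auto simp: height_def)
      then show ?thesis using inv(1)[of n] n(1) by (intro exI[of _ n]) auto
    qed
    moreover have "\<exists>N. \<forall>n\<ge>N. height (1 / ?x) n < a + \<delta>" if "\<delta> > 0" for \<delta>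
      using up[OF that] inv(3) by simp
    ultimately have "\<exists>n0. \<exists>t>0. \<forall>i\<ge>n0. letter (1 / ?x) (i + t) = letter (1 / ?x) i"
      using gap_imp_eventually_periodic[OF y \<epsilon>(1) gap'] by blast
    then show ?thesis unfolding inv(2) by simp
  qed
  then obtain n0 t where "t > 0" "\<And>i. i \<ge> n0 \<Longrightarrow> letter ?x (i + t) = letter ?x i" by blast
  moreover obtain N where "\<And>n. n \<ge> N \<Longrightarrow> height ?x n \<le> a + 1" using up[of 1] by (auto intro: less_imp_le)
  ultimately show ?thesis by (rule periodic_letters_imp_quadratic[OF irr])
qed

section \<open>Quadratic irrationals\<close>

lemma mobius_pair:
  fixes p q p1 q1 r s :: int and \<alpha> :: real
  assumes det: "p1 * s - q1 * r = 1" and \<kappa>: "\<kappa> = of_int p1 - of_int q1 * \<alpha>" "\<kappa> \<noteq> 0"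
    and \<beta>: "\<beta> = (of_int s * \<alpha> - of_int r) / \<kappa>"
    and \<delta>: "\<delta> = of_int p - of_int q * \<alpha>"
  shows "of_int (p1 * q - q1 * p) = \<kappa> * of_int q - of_int q1 * \<delta>"
    and "of_int (s * p - r * q) - of_int (p1 * q - q1 * p) * \<beta> = \<delta> / \<kappa>"
proof -
  show "of_int (p1 * q - q1 * p) = \<kappa> * of_int q - of_int q1 * \<delta>"
    by (simp add: \<kappa> \<delta> algebra_simps)
  have d: "real_of_int p1 * of_int s = 1 + of_int q1 * of_int r"
    using det by (metis add.commute diff_add_cancel of_int_1 of_int_add of_int_mult)
  have "\<kappa> * (of_int (s * p - r * q) - of_int (p1 * q - q1 * p) * \<beta>)
    = \<kappa> * of_int (s * p - r * q) - of_int (p1 * q - q1 * p) * (of_int s * \<alpha> - of_int r)"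
  proof -
    have "of_int s * \<alpha> - of_int r = \<kappa> * \<beta>" using \<kappa>(2) by (simp add: \<beta>)
    then show ?thesis by (simp add: algebra_simps)
  qed
  also have "\<dots> = (of_int p1 * of_int s - of_int q1 * of_int r) * (of_int p - of_int q * \<alpha>)"
    by (simp add: \<kappa> algebra_simps)
  also have "\<dots> = \<delta>" using d by (simp add: \<delta>)
  finally show "of_int (s * p - r * q) - of_int (p1 * q - q1 * p) * \<beta> = \<delta> / \<kappa>"
    using \<kappa>(2) by (simp add: field_simps)
qed

text \<open>The substitution divides the error \<open>\<delta>\<close> by \<open>\<kappa>\<close>
  and turns the denominator into \<open>\<kappa> * q - q1 * \<delta>\<close>, so the new product is
  exactly \<open>q * \<delta> - q1 * \<delta>\<^sup>2 / \<kappa>\<close>. The second-order term is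
  kept because attainability depends on it; the crude bound \<open>C\<close> makes the new
  denominators large.\<close>

lemma approximable_mobius:
  fixes p1 q1 r s :: int
  assumes det: "p1 * s - q1 * r = 1" and \<kappa>: "\<kappa> = of_int p1 - of_int q1 * \<alpha>" "\<kappa> \<noteq> 0"
    and \<beta>: "\<beta> = (of_int s * \<alpha> - of_int r) / \<kappa>"
    and C: "\<And>Q::int. \<exists>p q. q > Q \<and> q \<ge> 1 \<and> \<bar>of_int q * (of_int q * \<alpha> - of_int p)\<bar> \<le> C \<and>
      \<bar>of_int q * (of_int p - of_int q * \<alpha>) - of_int q1 * (of_int p - of_int q * \<alpha>)\<^sup>2 / \<kappa>\<bar> \<le> C'"
  shows "approximable \<beta> C'"
  unfolding approximable_def
proof
  fix Q :: int
  obtain p q where q: "q > \<lceil>(\<bar>of_int Q\<bar> + 1 + \<bar>of_int q1\<bar> * \<bar>C\<bar>) / \<bar>\<kappa>\<bar>\<rceil>" "q \<ge> 1"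
    and qC: "\<bar>of_int q * (of_int q * \<alpha> - of_int p)\<bar> \<le> C"
    and qC': "\<bar>of_int q * (of_int p - of_int q * \<alpha>) - of_int q1 * (of_int p - of_int q * \<alpha>)\<^sup>2 / \<kappa>\<bar> \<le> C'"
    using C by blast
  define \<delta> where "\<delta> = of_int p - of_int q * \<alpha>"
  define q' where "q' = p1 * q - q1 * p"
  define p' where "p' = s * p - r * q"
  note pair = mobius_pair[OF det \<kappa> \<beta> \<delta>_def, folded q'_def p'_def]
  have "real_of_int q > (\<bar>of_int Q\<bar> + 1 + \<bar>of_int q1\<bar> * \<bar>C\<bar>) / \<bar>\<kappa>\<bar>" using q(1) by linarith
  then have 1: "\<bar>\<kappa>\<bar> * of_int q > \<bar>of_int Q\<bar> + 1 + \<bar>of_int q1\<bar> * \<bar>C\<bar>"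
    using \<kappa>(2) by (simp add: field_simps)
  have "\<bar>\<delta>\<bar> \<le> of_int q * \<bar>\<delta>\<bar>" using q(2) mult_right_mono[of 1 "real_of_int q" "\<bar>\<delta>\<bar>"] by simp
  also have "\<dots> \<le> \<bar>C\<bar>" using qC q(2) by (simp add: \<delta>_def abs_mult abs_minus_commute)
  finally have "\<bar>of_int q1 * \<delta>\<bar> \<le> \<bar>of_int q1\<bar> * \<bar>C\<bar>" by (simp add: abs_mult mult_left_mono)
  moreover have "\<bar>\<kappa> * of_int q\<bar> = \<bar>\<kappa>\<bar> * of_int q" using q by (simp add: abs_mult)
  ultimately have "\<bar>real_of_int q'\<bar> > \<bar>of_int Q\<bar> + 1" using 1 pair(1) by linarith
  then have big: "\<bar>q'\<bar> > Q" "\<bar>q'\<bar> \<ge> 1" by linarith+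
  have "of_int q' * (of_int p' - of_int q' * \<beta>) = of_int q * \<delta> - of_int q1 * \<delta>\<^sup>2 / \<kappa>"
    unfolding pair(2) unfolding pair(1) using \<kappa>(2) by (simp add: field_simps power2_eq_square)
  then have val: "\<bar>of_int q' * (of_int q' * \<beta> - of_int p')\<bar> \<le> C'"
    using qC' by (simp add: \<delta>_def[symmetric] abs_mult abs_minus_commute)
  show "\<exists>p q. q > Q \<and> q \<ge> 1 \<and> \<bar>real_of_int q * (real_of_int q * \<beta> - real_of_int p)\<bar> \<le> C'"
  proof (cases "q' > 0")
    case True
    then show ?thesis using big val by (intro exI[of _ p'] exI[of _ q']) auto
  next
    case False
    moreover have "real_of_int (- q') * (real_of_int (- q') * \<beta> - real_of_int (- p'))
      = of_int q' * (of_int q' * \<beta> - of_int p')" by (simp add: algebra_simps)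
    ultimately show ?thesis using big val by (intro exI[of _ "- p'"] exI[of _ "- q'"]) auto
  qed
qed

lemma mobius_irrational:
  fixes p1 q1 r s :: int and \<alpha> \<beta> :: real
  assumes det: "p1 * s - q1 * r = 1" and "\<alpha> \<notin> \<rat>"
  shows "of_int p1 - of_int q1 * \<alpha> \<noteq> 0"
    and "\<beta> = (of_int s * \<alpha> - of_int r) / (of_int p1 - of_int q1 * \<alpha>) \<Longrightarrow>
      \<beta> \<notin> \<rat> \<and> \<alpha> = (of_int p1 * \<beta> - of_int (- r)) / (of_int s - of_int (- q1) * \<beta>)"
proof -
  let ?\<kappa> = "of_int p1 - of_int q1 * \<alpha>"
  show \<kappa>: "?\<kappa> \<noteq> 0"
  proof
    assume *: "?\<kappa> = 0"
    have "q1 \<noteq> 0" using * det by auto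
    then have "\<alpha> = of_int p1 / of_int q1" using * by (simp add: field_simps)
    then show False using assms(2) by simp
  qed
  assume \<beta>: "\<beta> = (of_int s * \<alpha> - of_int r) / ?\<kappa>"
  have d: "real_of_int p1 * of_int s = 1 + of_int q1 * of_int r"
    using det by (metis add.commute diff_add_cancel of_int_1 of_int_add of_int_mult)
  have b: "\<beta> * ?\<kappa> = of_int s * \<alpha> - of_int r" using \<kappa> \<beta> by simp
  have "(of_int s + of_int q1 * \<beta>) * ?\<kappa> = of_int s * ?\<kappa> + of_int q1 * (\<beta> * ?\<kappa>)"
    by (simp only: distrib_right mult.assoc)
  also have "\<dots> = of_int p1 * of_int s - of_int q1 * of_int r" unfolding b by (simp add: algebra_simps)
  finally have e1: "(of_int s + of_int q1 * \<beta>) * ?\<kappa> = 1" using d by simp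
  have "(of_int p1 * \<beta> + of_int r) * ?\<kappa> = of_int p1 * (\<beta> * ?\<kappa>) + of_int r * ?\<kappa>"
    by (simp only: distrib_right mult.assoc)
  also have "\<dots> = (of_int p1 * of_int s - of_int q1 * of_int r) * \<alpha>" unfolding b by (simp add: algebra_simps)
  finally have "(of_int p1 * \<beta> + of_int r) * ?\<kappa> = \<alpha>" using d by simp
  with e1 have "of_int s + of_int q1 * \<beta> = 1 / ?\<kappa>" "of_int p1 * \<beta> + of_int r = \<alpha> / ?\<kappa>"
    using nonzero_eq_divide_eq[OF \<kappa>] by blast+
  then have \<alpha>: "\<alpha> = (of_int p1 * \<beta> - of_int (- r)) / (of_int s - of_int (- q1) * \<beta>)"
    using \<kappa> by simp
  moreover have "\<beta> \<notin> \<rat>"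
  proof
    assume "\<beta> \<in> \<rat>"
    then have "(of_int p1 * \<beta> - of_int (- r)) / (of_int s - of_int (- q1) * \<beta>) \<in> \<rat>"
      by (intro Rats_divide Rats_diff Rats_mult) auto
    then show False using \<alpha> assms(2) by simp
  qed
  ultimately show "\<beta> \<notin> \<rat> \<and> \<alpha> = (of_int p1 * \<beta> - of_int (- r)) / (of_int s - of_int (- q1) * \<beta>)" by blast
qed

text \<open>The second-order term tends to 0 as \<open>q\<close> grows and is absorbed by the slack
  between \<open>1 / c'\<close> and \<open>1 / c\<close>.\<close>

lemma lagrange_const_mobius_ge:
  fixes p1 q1 r s :: int
  assumes det: "p1 * s - q1 * r = 1" and irr: "\<alpha> \<notin> \<rat>"
    and \<beta>: "\<beta> = (of_int s * \<alpha> - of_int r) / (of_int p1 - of_int q1 * \<alpha>)"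
  shows "lagrange_const \<alpha> \<le> lagrange_const \<beta>"
proof (rule ccontr)
  assume "\<not> ?thesis"
  then obtain c where c: "lagrange_const \<beta> < ereal c" "ereal c < lagrange_const \<alpha>"
    using ereal_dense2 by (metis not_le)
  then obtain c' where c': "ereal c < ereal c'" "ereal c' < lagrange_const \<alpha>"
    using ereal_dense2 by blast
  define \<kappa> where "\<kappa> = of_int p1 - of_int q1 * \<alpha>"
  note \<kappa> = mobius_irrational(1)[OF det irr, folded \<kappa>_def]
  have "\<beta> \<notin> \<rat>" using mobius_irrational(2)[OF det irr \<beta>] by blast
  then have "1 < ereal c" using lagrange_const_ge_1 c(1) by (metis le_less_trans)
  then have cpos: "0 < c" "0 < c'" "c < c'" using c' by (auto simp: one_ereal_def)
  have ap: "approximable \<alpha> (1 / c')"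
    using c'(2) cpos by (intro lagrange_const_gt_imp_approximable)
  define C where "C = 1 / c'"
  have C: "C > 0" "C < 1 / c" using cpos by (auto simp: C_def frac_less2)
  have "approximable \<beta> (1 / c)"
  proof (rule approximable_mobius[OF det \<kappa>_def \<kappa> \<beta>[folded \<kappa>_def]])
    fix Q :: int
    let ?B = "\<bar>of_int q1 / \<kappa>\<bar> * C\<^sup>2 / (1 / c - C)"
    obtain p q where q: "q > max Q \<lceil>?B\<rceil>" "q \<ge> 1" "\<bar>of_int q * (of_int q * \<alpha> - of_int p)\<bar> \<le> C"
      using ap unfolding approximable_def C_def[symmetric] by blast
    define \<delta> where "\<delta> = of_int p - of_int q * \<alpha>"
    have q\<delta>: "of_int q * \<bar>\<delta>\<bar> \<le> C" using q by (simp add: \<delta>_def abs_mult abs_minus_commute)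
    have q1: "real_of_int q \<ge> 1" using q by simp
    have "(of_int q * \<bar>\<delta>\<bar>)\<^sup>2 \<le> C\<^sup>2" using q\<delta> q1 by (intro power_mono) auto
    moreover have "(of_int q * \<bar>\<delta>\<bar>)\<^sup>2 = of_int q * (of_int q * \<delta>\<^sup>2)"
      by (simp add: power_mult_distrib) (simp add: power2_eq_square)
    ultimately have "of_int q * (of_int q * \<delta>\<^sup>2) \<le> C\<^sup>2" by simp
    moreover have "of_int q * \<delta>\<^sup>2 * 1 \<le> of_int q * \<delta>\<^sup>2 * of_int q" using q1 by (intro mult_left_mono) auto
    ultimately have "of_int q * \<delta>\<^sup>2 \<le> C\<^sup>2" by (simp add: mult.commute mult.left_commute)
    then have "\<bar>of_int q1 / \<kappa>\<bar> * (of_int q * \<delta>\<^sup>2) \<le> \<bar>of_int q1 / \<kappa>\<bar> * C\<^sup>2" by (intro mult_left_mono) auto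
    moreover have "real_of_int q > ?B" using q(1) by linarith
    then have "\<bar>of_int q1 / \<kappa>\<bar> * C\<^sup>2 < of_int q * (1 / c - C)"
      using C(2) by (metis diff_gt_0_iff_gt pos_divide_less_eq)
    ultimately have "of_int q * (\<bar>of_int q1 / \<kappa>\<bar> * \<delta>\<^sup>2) < of_int q * (1 / c - C)"
      by (simp add: mult.left_commute)
    then have "\<bar>of_int q1 / \<kappa>\<bar> * \<delta>\<^sup>2 < 1 / c - C"
      by (rule mult_left_less_imp_less) (use q1 in simp)
    then have "\<bar>of_int q1 * \<delta>\<^sup>2 / \<kappa>\<bar> < 1 / c - C" by (simp add: abs_mult)
    moreover have "\<bar>of_int q * \<delta>\<bar> \<le> C" using q\<delta> q1 by (simp add: abs_mult)
    ultimately have "\<bar>of_int q * \<delta> - of_int q1 * \<delta>\<^sup>2 / \<kappa>\<bar> \<le> 1 / c" by linarith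
    then show "\<exists>p q. q > Q \<and> q \<ge> 1 \<and> \<bar>of_int q * (of_int q * \<alpha> - of_int p)\<bar> \<le> C \<and>
      \<bar>of_int q * (of_int p - of_int q * \<alpha>) - of_int q1 * (of_int p - of_int q * \<alpha>)\<^sup>2 / \<kappa>\<bar> \<le> 1 / c"
      using q unfolding \<delta>_def by (intro exI[of _ p] exI[of _ q]) auto
  qed
  then have "lagrange_const \<beta> \<ge> ereal c" using cpos by (intro approximable_imp_lagrange_const_ge)
  then show False using c(1) by simp
qed

lemma lagrange_const_mobius:
  fixes p1 q1 r s :: int
  assumes det: "p1 * s - q1 * r = 1" and irr: "\<alpha> \<notin> \<rat>"
    and \<beta>: "\<beta> = (of_int s * \<alpha> - of_int r) / (of_int p1 - of_int q1 * \<alpha>)"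
  shows "lagrange_const \<beta> = lagrange_const \<alpha>"
proof (rule antisym)
  have i: "\<beta> \<notin> \<rat>" "\<alpha> = (of_int p1 * \<beta> - of_int (- r)) / (of_int s - of_int (- q1) * \<beta>)"
    using mobius_irrational(2)[OF det irr \<beta>] by auto
  show "lagrange_const \<beta> \<le> lagrange_const \<alpha>"
    using det by (intro lagrange_const_mobius_ge[OF _ i]) (simp add: algebra_simps)
qed (rule lagrange_const_mobius_ge[OF assms])

section \<open>Integral forms at good approximations\<close>

lemma isolated_int: "\<exists>e>0. \<forall>z::int. \<bar>of_int z - t\<bar> < e \<longrightarrow> of_int z = (t::real)"
proof (cases "t \<in> \<int>")
  case True
  then obtain y where y: "t = of_int y" by (auto elim: Ints_cases)
  show ?thesis
  proof (intro exI[of _ 1] conjI allI impI)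
    fix z :: int assume "\<bar>of_int z - t\<bar> < 1"
    then have "real_of_int \<bar>z - y\<bar> < 1" by (simp add: y)
    then have "\<bar>z - y\<bar> < 1" by (simp only: of_int_less_1_iff)
    then show "of_int z = t" by (simp add: y)
  qed simp
next
  case False
  then have f: "frac t \<noteq> 0" by (simp add: frac_eq_0_iff)
  show ?thesis
  \<comment> \<open>For non-integral \<open>t\<close> this is the distance to the nearest integer,
    so no integer satisfies the premise.\<close>
  proof (intro exI[of _ "min (frac t) (1 - frac t)"] conjI allI impI)
    show "0 < min (frac t) (1 - frac t)" using f frac_ge_0[of t] frac_lt_1[of t] by linarith
    fix z :: int assume *: "\<bar>of_int z - t\<bar> < min (frac t) (1 - frac t)"
    then have "of_int z > real_of_int \<lfloor>t\<rfloor>" "of_int z < real_of_int \<lfloor>t\<rfloor> + 1"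
      unfolding frac_def by linarith+
    then have "z > \<lfloor>t\<rfloor>" "z < \<lfloor>t\<rfloor> + 1" by linarith+
    then show "of_int z = t" by simp
  qed
qed

text \<open>Taylor expansion of the form in its first argument at \<open>q * \<alpha>\<close>: the
  constant term vanishes because \<open>\<alpha>\<close> is a root, and \<open>D\<close> is the
  derivative of the polynomial there.\<close>

lemma quadratic_form_expand:
  fixes A B E p q :: int and \<alpha> :: real
  assumes "of_int A * \<alpha>\<^sup>2 + of_int B * \<alpha> + of_int E = 0" "D = 2 * of_int A * \<alpha> + of_int B"
  shows "of_int (A * p\<^sup>2 + B * p * q + E * q\<^sup>2)
    = D * (of_int q * (of_int p - of_int q * \<alpha>)) + of_int A * (of_int p - of_int q * \<alpha>)\<^sup>2"
proof -
  have "of_int E = - (of_int A * \<alpha>\<^sup>2) - of_int B * \<alpha>" using assms(1) by linarith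
  then show ?thesis by (simp add: assms(2)) (simp add: algebra_simps power2_eq_square)
qed

lemma quadratic_root_simple:
  fixes A B :: int and \<alpha> :: real
  assumes "\<alpha> \<notin> \<rat>" "A \<noteq> 0" "D = 2 * of_int A * \<alpha> + of_int B"
  shows "D \<noteq> 0"
proof
  assume "D = 0"
  then have "\<alpha> = - of_int B / (2 * of_int A)" using assms by (simp add: field_simps)
  then show False
    using assms(1) by (metis Rats_divide Rats_minus_iff Rats_mult Rats_number_of Rats_of_int)
qed

text \<open>On good approximations the form takes the value \<open>D q (p - q \<alpha>) + o(1)\<close>; being an
  integer, it is eventually constant up to sign.\<close>

lemma quadratic_form_constant_value:
  fixes A B E :: int
  assumes irr: "\<alpha> \<notin> \<rat>" and A: "A \<noteq> 0" and root: "of_int A * \<alpha>\<^sup>2 + of_int B * \<alpha> + of_int E = 0"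
    and a: "lagrange_const \<alpha> = ereal a" "a > 0" and D: "D = 2 * of_int A * \<alpha> + of_int B"
  obtains v :: int where "\<bar>of_int v\<bar> = \<bar>D\<bar> / a"
    and "\<And>Q::int. \<exists>p q. q > Q \<and> q \<ge> 1 \<and> \<bar>of_int q * (of_int q * \<alpha> - of_int p)\<bar> \<le> 2 / a \<and>
      A * p\<^sup>2 + B * p * q + E * q\<^sup>2 = v"
proof -
  let ?f = "\<lambda>p q. A * p\<^sup>2 + B * p * q + E * q\<^sup>2"
  note form = quadratic_form_expand[OF root D] and D0 = quadratic_root_simple[OF irr A D]
  obtain e where e: "e > 0" "\<And>z::int. \<bar>of_int z - \<bar>D\<bar> / a\<bar> < e \<Longrightarrow> of_int z = \<bar>D\<bar> / a"
    using isolated_int[of "\<bar>D\<bar> / a"] by blast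
  \<comment> \<open>Half of the isolation radius \<open>e\<close> pays for the deviation of the
    product from \<open>1 / a\<close>, the other half for the quadratic term;
    \<open>\<eta> \<le> 1 / a\<close> yields the bound \<open>2 / a\<close>.\<close>
  define \<eta> where "\<eta> = min (1 / a) (e / (2 * \<bar>D\<bar>))"
  have \<eta>: "\<eta> > 0" "\<eta> \<le> 1 / a" "\<bar>D\<bar> * \<eta> \<le> e / 2"
  proof -
    show "\<eta> > 0" "\<eta> \<le> 1 / a" using e a D0 by (auto simp: \<eta>_def)
    have "\<bar>D\<bar> * \<eta> \<le> \<bar>D\<bar> * (e / (2 * \<bar>D\<bar>))" by (intro mult_left_mono) (auto simp: \<eta>_def)
    then show "\<bar>D\<bar> * \<eta> \<le> e / 2" using D0 by simp
  qed
  have ap: "approximable \<alpha> (1 / a + \<eta>)"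
  proof -
    have "1 / (1 / a + \<eta>) < 1 / (1 / a)"
      using \<eta> a by (intro divide_strict_left_mono) (auto simp: add_pos_pos)
    then have "1 / (1 / a + \<eta>) < a" by simp
    then have "approximable \<alpha> (1 / (1 / (1 / a + \<eta>)))"
      using a \<eta> by (intro lagrange_const_gt_imp_approximable) (auto simp: add_pos_pos)
    then show ?thesis by simp
  qed
  have nap: "\<not> approximable \<alpha> (1 / a - \<eta>)"
  proof
    assume *: "approximable \<alpha> (1 / a - \<eta>)"
    have "1 / a - \<eta> < 1 / a" using \<eta> by simp
    then obtain w where w: "max (1 / a - \<eta>) 0 < w" "w < 1 / a" using a dense[of "max (1 / a - \<eta>) 0" "1 / a"] by auto
    then have "approximable \<alpha> (1 / (1 / w))" using approximable_mono[OF *, of w] by simp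
    then have "lagrange_const \<alpha> \<ge> ereal (1 / w)" using w by (intro approximable_imp_lagrange_const_ge) auto
    then have "1 / w \<le> a" using a by simp
    then show False using w a by (simp add: field_simps)
  qed
  then obtain Q0 where Q0: "\<And>p q. q > Q0 \<Longrightarrow> q \<ge> 1 \<Longrightarrow> \<bar>of_int q * (of_int q * \<alpha> - of_int p)\<bar> > 1 / a - \<eta>"
    unfolding approximable_def by (meson not_le)
  have many: "\<exists>p q. q > Q \<and> q \<ge> 1 \<and> \<bar>of_int q * (of_int q * \<alpha> - of_int p)\<bar> \<le> 2 / a \<and> of_int \<bar>?f p q\<bar> = \<bar>D\<bar> / a" for Q :: int
  proof -
    let ?X = "\<bar>of_int A\<bar> * (2 / a)\<^sup>2 / (e / 2)"
    obtain p q where q: "q > max (max Q Q0) \<lceil>?X\<rceil>" "q \<ge> 1" "\<bar>of_int q * (of_int q * \<alpha> - of_int p)\<bar> \<le> 1 / a + \<eta>"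
      using ap unfolding approximable_def by blast
    define \<delta> where "\<delta> = of_int p - of_int q * \<alpha>"
    have q1: "real_of_int q \<ge> 1" using q by simp
    have "\<bar>of_int q * (of_int q * \<alpha> - of_int p)\<bar> = \<bar>of_int q * \<delta>\<bar>"
      by (simp add: \<delta>_def abs_mult abs_minus_commute)
    then have lo: "\<bar>of_int q * \<delta>\<bar> > 1 / a - \<eta>" and up: "\<bar>of_int q * \<delta>\<bar> \<le> 1 / a + \<eta>"
      using Q0[of q p] q by auto
    have up2: "\<bar>of_int q * \<delta>\<bar> \<le> 2 / a" using up \<eta> by simp
    have "(\<bar>of_int q * \<delta>\<bar>)\<^sup>2 \<le> (2 / a)\<^sup>2" using up2 by (intro power_mono) auto
    moreover have "(\<bar>of_int q * \<delta>\<bar>)\<^sup>2 = of_int q * (of_int q * \<delta>\<^sup>2)"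
      by (simp add: power_mult_distrib) (simp add: power2_eq_square)
    ultimately have "of_int q * (of_int q * \<delta>\<^sup>2) \<le> (2 / a)\<^sup>2" by simp
    moreover have "of_int q * \<delta>\<^sup>2 * 1 \<le> of_int q * \<delta>\<^sup>2 * of_int q" using q1 by (intro mult_left_mono) auto
    ultimately have "of_int q * \<delta>\<^sup>2 \<le> (2 / a)\<^sup>2" by (simp add: mult.commute mult.left_commute)
    then have "\<bar>of_int A\<bar> * (of_int q * \<delta>\<^sup>2) \<le> \<bar>of_int A\<bar> * (2 / a)\<^sup>2" by (intro mult_left_mono) auto
    moreover have "real_of_int q > ?X" using q(1) by linarith
    then have "\<bar>of_int A\<bar> * (2 / a)\<^sup>2 < of_int q * (e / 2)" using e by (simp add: pos_divide_less_eq)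
    ultimately have "of_int q * (\<bar>of_int A\<bar> * \<delta>\<^sup>2) < of_int q * (e / 2)"
      by (simp add: mult.left_commute)
    then have "\<bar>of_int A * \<delta>\<^sup>2\<bar> < e / 2" using q1 by (simp add: abs_mult)
    moreover have "\<bar>\<bar>D * (of_int q * \<delta>)\<bar> - \<bar>D\<bar> / a\<bar> \<le> e / 2"
    proof -
      have "\<bar>D * (of_int q * \<delta>)\<bar> - \<bar>D\<bar> / a = \<bar>D\<bar> * (\<bar>of_int q * \<delta>\<bar> - 1 / a)"
        by (simp add: abs_mult right_diff_distrib)
      then have "\<bar>\<bar>D * (of_int q * \<delta>)\<bar> - \<bar>D\<bar> / a\<bar> = \<bar>D\<bar> * \<bar>\<bar>of_int q * \<delta>\<bar> - 1 / a\<bar>"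
        by (simp add: abs_mult)
      also have "\<dots> \<le> \<bar>D\<bar> * \<eta>" using lo up by (intro mult_left_mono) auto
      finally show ?thesis using \<eta> by simp
    qed
    moreover have "real_of_int (?f p q) = D * (of_int q * \<delta>) + of_int A * \<delta>\<^sup>2"
      using form[of p q] by (simp only: \<delta>_def)
    ultimately have "\<bar>\<bar>real_of_int (?f p q)\<bar> - \<bar>D\<bar> / a\<bar> < e" by linarith
    then have "\<bar>real_of_int \<bar>?f p q\<bar> - \<bar>D\<bar> / a\<bar> < e" by simp
    then have "real_of_int \<bar>?f p q\<bar> = \<bar>D\<bar> / a" by (rule e(2))
    then show ?thesis using q up2 \<open>\<bar>of_int q * (of_int q * \<alpha> - of_int p)\<bar> = \<bar>of_int q * \<delta>\<bar>\<close>
      by (intro exI[of _ p] exI[of _ q]) auto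
  qed
  obtain p0 q0 where "of_int \<bar>?f p0 q0\<bar> = \<bar>D\<bar> / a" using many[of 0] by blast
  then obtain v where v: "of_int \<bar>v\<bar> = \<bar>D\<bar> / a" by blast
  let ?P = "\<lambda>v (Q::int). \<exists>p q. q > Q \<and> q \<ge> 1 \<and> \<bar>of_int q * (of_int q * \<alpha> - of_int p)\<bar> \<le> 2 / a \<and> ?f p q = v"
  \<comment> \<open>The sign may vary with the approximation, but one sign must serve arbitrarily
    large denominators.\<close>
  have "\<forall>Q. ?P v Q \<or> ?P (- v) Q"
  proof
    fix Q
    obtain p q where pq: "q > Q" "q \<ge> 1" "\<bar>of_int q * (of_int q * \<alpha> - of_int p)\<bar> \<le> 2 / a" "of_int \<bar>?f p q\<bar> = \<bar>D\<bar> / a"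
      using many by blast
    then have "\<bar>?f p q\<bar> = \<bar>v\<bar>" using v by (metis of_int_eq_iff)
    then have "?f p q = v \<or> ?f p q = - v" by (simp only: abs_eq_iff)
    then show "?P v Q \<or> ?P (- v) Q" using pq by blast
  qed
  moreover have "?P w Q" if "?P w (max Q Q')" for w Q Q' using that by (metis max_less_iff_conj)
  moreover have "?P w Q'" if "?P w (max Q Q')" for w Q Q' using that by (metis max_less_iff_conj)
  ultimately consider "\<forall>Q. ?P v Q" | "\<forall>Q. ?P (- v) Q" by blast
  then show ?thesis
  proof cases
    case 1 then show ?thesis using that[of v] v by simp
  next
    case 2 then show ?thesis using that[of "- v"] v by simp
  qed
qed

text \<open>The form of \<open>\<beta>\<close> has leading coefficient \<open>A'\<close> with
  \<open>v = d\<^sup>2 * A'\<close>. For a good \<open>(p, q)\<close> of value \<open>v\<close>,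
  \<open>D\<close> times the new product equals
  \<open>A' * (d\<^sup>2 - \<delta>\<^sup>2 / \<kappa>\<^sup>2)\<close>. The subtracted term lies
  between 0 and 1, so the absolute value is at most that of \<open>v\<close>, which is
  \<open>\<bar>D\<bar> / a\<close>: the inequality holds without any loss.\<close>

lemma quadratic_imp_attainable:
  assumes quad: "quadratic_irrational \<alpha>" and a: "lagrange_const \<alpha> = ereal a"
  shows "\<exists>\<beta>. attainable \<beta> \<and> lagrange_const \<beta> = ereal a"
proof -
  obtain A B E :: int where irr: "\<alpha> \<notin> \<rat>" and A: "A \<noteq> 0"
    and root: "of_int A * \<alpha>\<^sup>2 + of_int B * \<alpha> + of_int E = 0"
    using quad unfolding quadratic_irrational_def by blast
  have "ereal a \<ge> 1" using lagrange_const_ge_1[OF irr] a by simp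
  then have a0: "a > 0" by (simp add: one_ereal_def)
  define D where "D = 2 * of_int A * \<alpha> + of_int B"
  define f where "f p q = A * p\<^sup>2 + B * p * q + E * q\<^sup>2" for p q
  obtain v where v: "\<bar>of_int v\<bar> = \<bar>D\<bar> / a"
    and many: "\<And>Q::int. \<exists>p q. q > Q \<and> q \<ge> 1 \<and> \<bar>of_int q * (of_int q * \<alpha> - of_int p)\<bar> \<le> 2 / a \<and> f p q = v"
    using quadratic_form_constant_value[OF irr A root a a0 D_def] unfolding f_def by blast
  note form = quadratic_form_expand[OF root D_def, folded f_def]
    and D0 = quadratic_root_simple[OF irr A D_def]
  obtain p0 q0 where p0: "q0 \<ge> 1" "f p0 q0 = v" using many[of 0] by blast
  \<comment> \<open>Only a primitive vector can be completed to a unimodular matrix, so the common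
    factor is split off.\<close>
  define d where "d = gcd p0 q0"
  have d: "d \<ge> 1" using p0 by (simp add: d_def) (smt (verit) gcd_pos_int)
  have "gcd p0 q0 \<noteq> 0" using d unfolding d_def by linarith
  then obtain p1 q1 where pq1: "p0 = p1 * d" "q0 = q1 * d" "coprime p1 q1"
    using gcd_coprime_exists[of p0 q0] unfolding d_def by blast
  obtain s r' where "s * p1 + r' * q1 = 1"
    using bezout_int[of p1 q1] pq1(3) by (auto simp: coprime_iff_gcd_eq_1)
  then have det: "p1 * s - q1 * (- r') = 1" by (simp add: algebra_simps)
  define r where "r = - r'"
  define \<kappa> where "\<kappa> = of_int p1 - of_int q1 * \<alpha>"
  note det = det[folded r_def]
  note \<kappa> = mobius_irrational(1)[OF det irr, folded \<kappa>_def]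
  define \<beta> where "\<beta> = (of_int s * \<alpha> - of_int r) / \<kappa>"
  have irr\<beta>: "\<beta> \<notin> \<rat>" using mobius_irrational(2)[OF det irr, of \<beta>] \<beta>_def \<kappa>_def by blast
  have lag: "lagrange_const \<beta> = ereal a"
    using lagrange_const_mobius[OF det irr \<beta>_def[unfolded \<kappa>_def]] a by simp
  define A' where "A' = f p1 q1"
  have vA': "v = d\<^sup>2 * A'"
    using p0(2) unfolding A'_def pq1 f_def by (simp add: algebra_simps power2_eq_square)
  have A'\<kappa>: "of_int A' = D * (of_int q1 * \<kappa>) + of_int A * \<kappa>\<^sup>2" unfolding A'_def \<kappa>_def by (rule form)
  have "approximable \<beta> (1 / a)"
  proof (rule approximable_mobius[OF det \<kappa>_def \<kappa> \<beta>_def])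
    fix Q :: int
    \<comment> \<open>As \<open>q * \<bar>\<delta>\<bar>\<close> is at most \<open>2 / a\<close>,
      denominators beyond \<open>?X\<close> have an error smaller than that of the vector moved to
      \<open>(1, 0)\<close>.\<close>
    let ?X = "(2 / a) / \<bar>\<kappa>\<bar>"
    obtain p q where q: "q > max Q \<lceil>?X\<rceil>" "q \<ge> 1" "\<bar>of_int q * (of_int q * \<alpha> - of_int p)\<bar> \<le> 2 / a" "f p q = v"
      using many by blast
    define \<delta> where "\<delta> = of_int p - of_int q * \<alpha>"
    have q1: "real_of_int q \<ge> 1" using q by simp
    have "real_of_int q > ?X" using q(1) by linarith
    moreover have "\<bar>\<kappa>\<bar> > 0" using \<kappa> by simp
    ultimately have "2 / a < of_int q * \<bar>\<kappa>\<bar>" by (simp only: pos_divide_less_eq)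
    moreover have "of_int q * \<bar>\<delta>\<bar> \<le> 2 / a" using q by (simp add: \<delta>_def abs_mult abs_minus_commute)
    ultimately have "of_int q * \<bar>\<delta>\<bar> < of_int q * \<bar>\<kappa>\<bar>" by linarith
    then have "\<bar>\<delta>\<bar> \<le> \<bar>\<kappa>\<bar>" using q1 by simp
    then have "\<delta>\<^sup>2 \<le> \<kappa>\<^sup>2" by (simp add: abs_le_square_iff)
    then have small: "\<delta>\<^sup>2 / \<kappa>\<^sup>2 \<le> 1" "\<delta>\<^sup>2 / \<kappa>\<^sup>2 \<ge> 0" using \<kappa> by auto
    have "of_int v = D * (of_int q * \<delta>) + of_int A * \<delta>\<^sup>2"
      using form[of p q] q(4) by (simp add: \<delta>_def)
    then have "D * (of_int q * \<delta>) = of_int v - of_int A * \<delta>\<^sup>2" by simp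
    then have "D * (of_int q * \<delta> - of_int q1 * \<delta>\<^sup>2 / \<kappa>) = of_int v - (D * (of_int q1 * \<kappa>) + of_int A * \<kappa>\<^sup>2) * (\<delta>\<^sup>2 / \<kappa>\<^sup>2)"
      using \<kappa> by (simp add: right_diff_distrib distrib_right) (simp add: field_simps power2_eq_square)
    also have "\<dots> = of_int A' * ((of_int d)\<^sup>2 - \<delta>\<^sup>2 / \<kappa>\<^sup>2)"
      unfolding A'\<kappa>[symmetric] vA' by (simp add: algebra_simps)
    finally have eq: "D * (of_int q * \<delta> - of_int q1 * \<delta>\<^sup>2 / \<kappa>) = of_int A' * ((of_int d)\<^sup>2 - \<delta>\<^sup>2 / \<kappa>\<^sup>2)" .
    have "(real_of_int d)\<^sup>2 \<ge> 1" using d by simp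
    then have "\<bar>(of_int d)\<^sup>2 - \<delta>\<^sup>2 / \<kappa>\<^sup>2\<bar> \<le> (of_int d)\<^sup>2" using small by linarith
    then have "\<bar>of_int A'\<bar> * \<bar>(of_int d)\<^sup>2 - \<delta>\<^sup>2 / \<kappa>\<^sup>2\<bar> \<le> \<bar>of_int A'\<bar> * (of_int d)\<^sup>2"
      by (intro mult_left_mono) auto
    also have "\<dots> = \<bar>of_int v\<bar>" unfolding vA' by (simp add: abs_mult)
    also have "\<dots> = \<bar>D\<bar> / a" by (fact v)
    finally have "\<bar>D\<bar> * \<bar>of_int q * \<delta> - of_int q1 * \<delta>\<^sup>2 / \<kappa>\<bar> \<le> \<bar>D\<bar> * (1 / a)"
      using arg_cong[OF eq, of abs] by (simp only: abs_mult) simp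
    then have "\<bar>of_int q * \<delta> - of_int q1 * \<delta>\<^sup>2 / \<kappa>\<bar> \<le> 1 / a"
      by (rule mult_left_le_imp_le) (use D0 in simp)
    then show "\<exists>p q. q > Q \<and> q \<ge> 1 \<and> \<bar>of_int q * (of_int q * \<alpha> - of_int p)\<bar> \<le> 2 / a \<and>
      \<bar>of_int q * (of_int p - of_int q * \<alpha>) - of_int q1 * (of_int p - of_int q * \<alpha>)\<^sup>2 / \<kappa>\<bar> \<le> 1 / a"
      using q unfolding \<delta>_def by (intro exI[of _ p] exI[of _ q]) auto
  qed
  then have "attainable \<beta>" using attainable_iff_approximable[OF lag a0] irr\<beta> by simp
  then show ?thesis using lag by blast
qed

theorem theorem2:
  fixes a :: real and b :: ereal
  assumes "maximal_gap (ereal a) b"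
  shows "admissible a \<longleftrightarrow> (\<exists>\<alpha>. quadratic_irrational \<alpha> \<and> lagrange_const \<alpha> = ereal a)"
proof
  assume "admissible a"
  then show "\<exists>\<alpha>. quadratic_irrational \<alpha> \<and> lagrange_const \<alpha> = ereal a"
    using attainable_gap_imp_quadratic[OF assms] unfolding admissible_def by blast
next
  assume "\<exists>\<alpha>. quadratic_irrational \<alpha> \<and> lagrange_const \<alpha> = ereal a"
  then show "admissible a"
    using quadratic_imp_attainable assms unfolding admissible_def maximal_gap_def by blast
qed

end
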